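(* Let $\mathcal{E}$ be a separable infinite dimensional real Banach space with a shrinking Schauder basis $\{e_i\}_{i=1}^\infty$, and let $\mathcal{K}=\mathcal{K}(\mathcal{E})$ be the compact operators on $\mathcal{E}$ with the operator norm. Then the induced sequence of general linear groups $\{\mathrm{GL}(n)\}_{n=1}^\infty$ is a Fredholm $\Delta$-filtration, with $\Delta=\{n^2\}_{n=1}^\infty$, of the Banach manifold $M=\mathrm{GL}_{\mathcal{K}}(\mathcal{E})$.
   Context: Notation: $\mathcal{L}(\mathcal{E})$ is the Banach algebra of bounded linear operators on $\mathcal{E}$; $\mathrm{GL}(\mathcal{E})$ is its group of invertible elements, with identity $I$; $\mathcal{E}^*$ is the dual space. Shrinking basis: a Schauder basis $\{e_i\}_{i=1}^\infty$ of $\mathcal{E}$ is shrinking if $\|f\|_n\to0$ as $n\to\infty$ for all $f\in\mathcal{E}^*$, where $\|f\|_n$ is the norm of $f$ restricted to the closure of the span of $\{e_i : i\ge n\}$. Induced groups: put $E_n=\operatorname{span}\{e_1,\dots,e_n\}$ and $E^{\infty-n}=\overline{\operatorname{span}\{e_i : i\ge n+1\}}$. $\mathrm{GL}(n)$ is the subgroup of $\mathrm{GL}(\mathcal{E})$ of operators that map $E_n$ to itself and are the identity on $E^{\infty-n}$ (so $\mathrm{GL}(n)\cong\mathrm{GL}(E_n)$ and $\mathrm{GL}(n)\subset\mathrm{GL}(n+1)\subset\mathrm{GL}_{\mathcal{K}}(\mathcal{E})$). Fredholm group: $\mathrm{GL}_{\mathcal{K}}(\mathcal{E})=\mathrm{GL}(\mathcal{E})\cap(I+\mathcal{K}(\mathcal{E}))$,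 with the topology and smooth Banach manifold structure modelled on $\mathcal{K}(\mathcal{E})$ for which the bijection $I+K\mapsto K$ onto the open subset $\mathcal{O}=\{K\in\mathcal{K}(\mathcal{E}) : I+K\text{ is invertible}\}$ is a diffeomorphism (a global chart). $\Delta$-flag: let $\Delta=\{\delta(n)\}_{n=1}^\infty$ be a strictly increasing sequence of natural numbers. A $\Delta$-flag in a Banach space $B$ is a sequence $\{B_n\}_{n=1}^\infty$ of finite-dimensional subspaces of $B$ such that for all $n\ge 1$: (a) $\dim(B_n)=\delta(n)$; (b) $B_n\subset B_{n+1}$; (c) $\bigcup_{n} B_n$ is dense in $B$; (d) $B_n$ has a closed complement $B^{\infty-n}$ in $B$; (e) $B^{\infty-n}\supset B^{\infty-(n+1)}$. Fredholm map: a smooth map $f:M\to N$ of smooth Banach manifolds is Fredholm of index zero if for each $x\in M$ the differential $Df(x):T_xM\to T_{f(x)}N$ is a Fredholm operator of index $0$. Fredholm $\Delta$-filtration: let $M$ be a smooth Banach manifold and $\Delta=\{\delta(n)\}_{n=1}^\infty$ a strictly increasing sequence of natural numbers. A Fredholm $\Delta$-filtration of $M$ is a sequence $\{M_n\}_{n=1}^\infty$ of smooth submanifolds of $M$ such that for all $n\ge1$: (a) $\dim(M_n)=\delta(n)$; (b) $M_n\subset M_{n+1}$; (c) the embeddings $M_n\hookrightarrow M_{n+1}$ and $M_n\hookrightarrow M$ have trivial normal bundles; (d) $M_\infty=\bigcup_{n=1}^\infty M_n$ is dense in $M$; (e) if $M_\infty$ is given the inductive limit topology, the inclusion $M_\infty\hookrightarrow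 M$ is a homotopy equivalence; (f) there is a Fredholm map of index zero $f:M\to B$ to a Banach space $B$ that is transverse to (each term of) a $\Delta$-flag $\{B_n\}_{n=1}^\infty$ of $B$ for which $M_n=f^{-1}(B_n)$ for all $n\ge1$. *)

theory Defs
  imports "HOL-Analysis.Analysis"
begin

section \<open>Dimension, codimension and Fredholm operators\<close>

text \<open>The library function \<open>dim\<close> is 0 on infinite-dimensional spaces, so finite dimension is
  expressed by exhibiting a finite basis.\<close>

definition has_dim :: "'a::real_vector set \<Rightarrow> nat \<Rightarrow> bool" where
  "has_dim V n \<longleftrightarrow> (\<exists>B. independent B \<and> finite B \<and> card B = n \<and> span B = V)"

definition direct_sum :: "'a::real_vector set \<Rightarrow> 'a set \<Rightarrow> 'a set \<Rightarrow> bool" where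
  "direct_sum V W Z \<longleftrightarrow>
     subspace V \<and> subspace W \<and> V \<inter> W = {0} \<and> {v + w |v w. v \<in> V \<and> w \<in> W} = Z"

definition has_codim :: "'a::real_vector set \<Rightarrow> nat \<Rightarrow> bool" where
  "has_codim V n \<longleftrightarrow> (\<exists>W. direct_sum V W UNIV \<and> has_dim W n)"

definition fredholm_operator ::
    "('a::real_normed_vector \<Rightarrow> 'b::real_normed_vector) \<Rightarrow> int \<Rightarrow> bool" where
  "fredholm_operator T i \<longleftrightarrow>
     bounded_linear T \<and> closed (range T) \<and>
     (\<exists>k l. has_dim {v. T v = 0} k \<and> has_codim (range T) l \<and> i = int k - int l)"

section \<open>Smooth maps between normed spaces\<close>

definition bounded_multilinear ::
    "nat \<Rightarrow> ('a::real_normed_vector list \<Rightarrow> 'b::real_normed_vector) \<Rightarrow> bool" where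
  "bounded_multilinear k L \<longleftrightarrow>
     (\<forall>vs i. length vs = k \<and> i < k \<longrightarrow> linear (\<lambda>v. L (vs[i := v]))) \<and>
     (\<exists>C. \<forall>vs. length vs = k \<longrightarrow> norm (L vs) \<le> C * prod_list (map norm vs))"

text \<open>\<open>D k x\<close> is the \<open>k\<close>-th Frechet derivative of \<open>f\<close> at \<open>x\<close>, a bounded \<open>k\<close>-linear form whose
  arguments are given as a list of length \<open>k\<close>.  The last clause says that \<open>D (Suc k)\<close> is the Frechet
  derivative of \<open>D k\<close> with respect to the operator norm on \<open>k\<close>-linear forms.\<close>

definition smooth_on ::
    "'a::real_normed_vector set \<Rightarrow> ('a \<Rightarrow> 'b::real_normed_vector) \<Rightarrow> bool" where
  "smooth_on S f \<longleftrightarrow> open S \<and>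
     (\<exists>D :: nat \<Rightarrow> 'a \<Rightarrow> 'a list \<Rightarrow> 'b.
        (\<forall>x\<in>S. D 0 x [] = f x) \<and>
        (\<forall>k. \<forall>x\<in>S. bounded_multilinear k (D k x)) \<and>
        (\<forall>k. \<forall>x\<in>S. \<forall>\<epsilon>>0. \<forall>\<^sub>F y in at x. \<forall>vs. length vs = k \<longrightarrow>
           norm (D k y vs - D k x vs - D (Suc k) x ((y - x) # vs))
             \<le> \<epsilon> * norm (y - x) * prod_list (map norm vs)))"

definition locally_smooth_on ::
    "'a::real_normed_vector set \<Rightarrow> ('a \<Rightarrow> 'b::real_normed_vector) \<Rightarrow> bool" where
  "locally_smooth_on S f \<longleftrightarrow>
     (\<forall>p\<in>S. \<exists>U g. p \<in> U \<and> smooth_on U g \<and> (\<forall>q\<in>S \<inter> U. g q = f q))"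

definition diffeo ::
    "('a::real_normed_vector \<Rightarrow> 'b::real_normed_vector) \<Rightarrow> 'a set \<Rightarrow> 'b set \<Rightarrow> bool" where
  "diffeo h V W \<longleftrightarrow> bij_betw h V W \<and> smooth_on V h \<and> smooth_on W (inv_into V h)"

section \<open>Smooth Banach manifolds\<close>

text \<open>A manifold is given by an atlas: a set of charts \<open>(U, \<phi>)\<close> with values in the Banach space
  \<open>'m\<close>.  The atlas need not be maximal; the notions below are invariant under chart changes.\<close>

type_synonym ('a, 'm) atlas = "('a set \<times> ('a \<Rightarrow> 'm)) set"

definition mcarrier :: "('a, 'm) atlas \<Rightarrow> 'a set" where
  "mcarrier A = (\<Union>(U, \<phi>)\<in>A. U)"

definition mtopology :: "('a, 'm::topological_space) atlas \<Rightarrow> 'a topology" where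
  "mtopology A = topology (\<lambda>V. V \<subseteq> mcarrier A \<and> (\<forall>(U, \<phi>)\<in>A. open (\<phi> ` (V \<inter> U))))"

definition banach_manifold :: "('a, 'm::banach) atlas \<Rightarrow> bool" where
  "banach_manifold A \<longleftrightarrow>
     (\<forall>(U, \<phi>)\<in>A. inj_on \<phi> U \<and> open (\<phi> ` U)) \<and>
     (\<forall>(U, \<phi>)\<in>A. \<forall>(U', \<psi>)\<in>A. smooth_on (\<phi> ` (U \<inter> U')) (\<psi> \<circ> inv_into U \<phi>)) \<and>
     Hausdorff_space (mtopology A)"

lemma openin_mtopology:
  fixes A :: "('a, 'm::banach) atlas"
  assumes "banach_manifold A"
  shows "openin (mtopology A) V \<longleftrightarrow>
    V \<subseteq> mcarrier A \<and> (\<forall>(U, \<phi>)\<in>A. open (\<phi> ` (V \<inter> U)))"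
proof -
  let ?P = "\<lambda>V. V \<subseteq> mcarrier A \<and> (\<forall>(U, \<phi>)\<in>A. open (\<phi> ` (V \<inter> U)))"
  have inj: "inj_on \<phi> U" if "(U, \<phi>) \<in> A" for U \<phi>
    using assms that by (auto simp: banach_manifold_def)
  have "istopology ?P"
    unfolding istopology_def
  proof (intro conjI allI impI)
    fix S T assume S: "?P S" and T: "?P T"
    have "open (\<phi> ` (S \<inter> T \<inter> U))" if "(U, \<phi>) \<in> A" for U \<phi>
    proof -
      have "\<phi> ` (S \<inter> T \<inter> U) = \<phi> ` (S \<inter> U) \<inter> \<phi> ` (T \<inter> U)"
        using inj_on_image_Int[OF inj[OF that], of "S \<inter> U" "T \<inter> U"]
        by (simp add: Int_ac)
      moreover have "open (\<phi> ` (S \<inter> U))" "open (\<phi> ` (T \<inter> U))"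
        using S T that by auto
      ultimately show ?thesis by auto
    qed
    then show "S \<inter> T \<subseteq> mcarrier A" "\<forall>(U, \<phi>)\<in>A. open (\<phi> ` (S \<inter> T \<inter> U))"
      using S by auto
  next
    fix \<K> assume K: "\<forall>S\<in>\<K>. ?P S"
    have "open (\<phi> ` (\<Union>\<K> \<inter> U))" if "(U, \<phi>) \<in> A" for U \<phi>
    proof -
      have "\<phi> ` (\<Union>\<K> \<inter> U) = (\<Union>S\<in>\<K>. \<phi> ` (S \<inter> U))" by blast
      moreover have "open (\<phi> ` (S \<inter> U))" if "S \<in> \<K>" for S
        using K \<open>(U, \<phi>) \<in> A\<close> that by blast
      ultimately show ?thesis by (metis open_UN)
    qed
    then show "\<Union>\<K> \<subseteq> mcarrier A" "\<forall>(U, \<phi>)\<in>A. open (\<phi> ` (\<Union>\<K> \<inter> U))"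
      using K by blast+
  qed
  then show ?thesis
    by (simp only: mtopology_def topology_inverse')
qed

text \<open>Openness of the domain required by \<open>smooth_on\<close> for all charts includes continuity.\<close>

definition smooth_map ::
    "('a, 'm::banach) atlas \<Rightarrow> ('b, 'n::banach) atlas \<Rightarrow> ('a \<Rightarrow> 'b) \<Rightarrow> bool" where
  "smooth_map A A' f \<longleftrightarrow> f ` mcarrier A \<subseteq> mcarrier A' \<and>
     (\<forall>(U, \<phi>)\<in>A. \<forall>(U', \<psi>)\<in>A'. smooth_on (\<phi> ` (U \<inter> f -` U')) (\<psi> \<circ> f \<circ> inv_into U \<phi>))"

definition chart_differential ::
    "'a set \<times> ('a \<Rightarrow> 'm::banach) \<Rightarrow> 'b set \<times> ('b \<Rightarrow> 'n::banach) \<Rightarrow> ('a \<Rightarrow> 'b) \<Rightarrow> 'a \<Rightarrow> 'm \<Rightarrow> 'n"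
  where
  "chart_differential c d f x =
     frechet_derivative (snd d \<circ> f \<circ> inv_into (fst c) (snd c)) (at (snd c x))"

definition fredholm_map ::
    "('a, 'm::banach) atlas \<Rightarrow> ('b, 'n::banach) atlas \<Rightarrow> ('a \<Rightarrow> 'b) \<Rightarrow> int \<Rightarrow> bool" where
  "fredholm_map A A' f i \<longleftrightarrow> smooth_map A A' f \<and>
     (\<forall>c\<in>A. \<forall>d\<in>A'. \<forall>x \<in> fst c \<inter> f -` fst d. fredholm_operator (chart_differential c d f x) i)"

definition banach_space_atlas :: "('b::banach, 'b) atlas" where
  "banach_space_atlas = {(UNIV, id)}"

text \<open>The target is the Banach space \<open>'b\<close>, and \<open>T\<^sub>y S = S\<close> because \<open>S\<close> is a linear subspace.\<close>

definition transverse_to_subspace ::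
    "('a, 'm::banach) atlas \<Rightarrow> ('a \<Rightarrow> 'b::banach) \<Rightarrow> 'b set \<Rightarrow> bool" where
  "transverse_to_subspace A f S \<longleftrightarrow>
     (\<forall>c\<in>A. \<forall>x \<in> fst c \<inter> f -` S. let D = chart_differential c (UNIV, id) f x in
        {D v + s |v s. s \<in> S} = UNIV \<and>
        (\<exists>C. closed C \<and> direct_sum (D -` S) C UNIV))"

section \<open>Submanifolds and normal bundles\<close>

text \<open>Slice charts.  No complement of \<open>F\<close> is mentioned since finite-dimensional subspaces of
  Banach spaces are complemented.\<close>

definition submanifold_dim :: "('a, 'm::banach) atlas \<Rightarrow> nat \<Rightarrow> 'a set \<Rightarrow> bool" where
  "submanifold_dim A k N \<longleftrightarrow> N \<subseteq> mcarrier A \<and>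
     (\<forall>(U, \<phi>)\<in>A. \<forall>x\<in>N \<inter> U. \<exists>V W (h :: 'm \<Rightarrow> 'm) F.
        \<phi> x \<in> V \<and> V \<subseteq> \<phi> ` U \<and> diffeo h V W \<and> has_dim F k \<and>
        h ` (V \<inter> \<phi> ` (N \<inter> U)) = W \<inter> F)"

text \<open>The tangent space at \<open>x\<close> of a submanifold \<open>N\<close>, as a subspace of the model space by means of
  the chart \<open>c\<close>.\<close>

definition tangent_space :: "'a set \<times> ('a \<Rightarrow> 'm::banach) \<Rightarrow> 'a set \<Rightarrow> 'a \<Rightarrow> 'm set" where
  "tangent_space c N x = {v. \<exists>\<epsilon>>0. \<exists>\<gamma>.
     smooth_on {-\<epsilon><..<\<epsilon>::real} \<gamma> \<and> \<gamma> ` {-\<epsilon><..<\<epsilon>} \<subseteq> snd c ` (N \<inter> fst c) \<and>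
     \<gamma> 0 = snd c x \<and> (\<gamma> has_vector_derivative v) (at 0)}"

text \<open>Triviality of the normal bundle \<open>TP|N / TN\<close> of \<open>N\<close> in \<open>P\<close>, where \<open>N \<subseteq> P\<close> are submanifolds (\<open>P\<close>
  may be the whole manifold).  An isomorphism of this quotient bundle with \<open>N \<times> Q\<close> is the same as
  a smooth, fibrewise linear map \<open>\<tau>\<close> from \<open>TP|N\<close> onto \<open>N \<times> Q\<close> with kernel \<open>TN\<close>; \<open>\<tau> c x\<close> is its
  expression on the fibre over \<open>x\<close> in the chart \<open>c\<close>, and the last clause says that these expressions
  define a map on \<open>TP|N\<close>.  The fibre \<open>Q\<close> may be taken inside \<open>'m\<close>, because every fibre of the
  normal bundle is isomorphic to a complement of \<open>T\<^sub>x N\<close> in \<open>T\<^sub>x P\<close>.\<close>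

definition trivial_normal_bundle ::
    "('a, 'm::banach) atlas \<Rightarrow> 'a set \<Rightarrow> 'a set \<Rightarrow> bool" where
  "trivial_normal_bundle A N P \<longleftrightarrow>
     (\<exists>(Q :: 'm set) (\<tau> :: 'a set \<times> ('a \<Rightarrow> 'm) \<Rightarrow> 'a \<Rightarrow> 'm \<Rightarrow> 'm).
        subspace Q \<and> closed Q \<and>
        (\<forall>c\<in>A. \<forall>x\<in>N \<inter> fst c.
           (\<forall>v\<in>tangent_space c P x. \<forall>w\<in>tangent_space c P x. \<forall>a b.
              \<tau> c x (a *\<^sub>R v + b *\<^sub>R w) = a *\<^sub>R \<tau> c x v + b *\<^sub>R \<tau> c x w) \<and>
           \<tau> c x ` tangent_space c P x = Q \<and>
           {v \<in> tangent_space c P x. \<tau> c x v = 0} = tangent_space c N x) \<and>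
        (\<forall>c\<in>A. locally_smooth_on
           {(snd c x, v) |x v. x \<in> N \<inter> fst c \<and> v \<in> tangent_space c P x}
           (\<lambda>(p, v). \<tau> c (inv_into (fst c) (snd c) p) v)) \<and>
        (\<forall>c\<in>A. \<forall>d\<in>A. \<forall>x\<in>N \<inter> fst c \<inter> fst d. \<forall>v\<in>tangent_space c P x.
           \<tau> d x (chart_differential c d id x v) = \<tau> c x v))"

section \<open>Flags and Fredholm filtrations\<close>

text \<open>Sequences are indexed by \<open>n \<ge> 1\<close>; the value at 0 is irrelevant.\<close>

definition delta_flag :: "(nat \<Rightarrow> nat) \<Rightarrow> (nat \<Rightarrow> 'b::banach set) \<Rightarrow> bool" where
  "delta_flag \<delta> B \<longleftrightarrow>
     (\<forall>n\<ge>1. has_dim (B n) (\<delta> n) \<and> B n \<subseteq> B (Suc n)) \<and>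
     closure (\<Union>n\<in>{1..}. B n) = UNIV \<and>
     (\<exists>C. \<forall>n\<ge>1. closed (C n) \<and> direct_sum (B n) (C n) UNIV \<and> C (Suc n) \<subseteq> C n)"

definition inductive_limit_topology :: "'a topology \<Rightarrow> (nat \<Rightarrow> 'a set) \<Rightarrow> 'a topology" where
  "inductive_limit_topology X N = topology (\<lambda>V.
     V \<subseteq> (\<Union>n\<in>{1..}. N n) \<and> (\<forall>n\<ge>1. openin (subtopology X (N n)) (V \<inter> N n)))"

lemma openin_inductive_limit_topology:
  "openin (inductive_limit_topology X N) V \<longleftrightarrow>
     V \<subseteq> (\<Union>n\<in>{1..}. N n) \<and> (\<forall>n\<ge>1. openin (subtopology X (N n)) (V \<inter> N n))"
proof -
  have "istopology (\<lambda>V.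
     V \<subseteq> (\<Union>n\<in>{1..}. N n) \<and> (\<forall>n\<ge>1. openin (subtopology X (N n)) (V \<inter> N n)))"
    (is "istopology ?P")
    unfolding istopology_def
  proof (intro conjI allI impI)
    fix S T assume S: "?P S" and T: "?P T"
    then show "S \<inter> T \<subseteq> (\<Union>n\<in>{1..}. N n)" by blast
    fix n :: nat assume "1 \<le> n"
    then have "openin (subtopology X (N n)) ((S \<inter> N n) \<inter> (T \<inter> N n))"
      using S T by blast
    then show "openin (subtopology X (N n)) (S \<inter> T \<inter> N n)"
      by (metis Int_absorb Int_assoc Int_left_commute)
  next
    fix \<K> assume K: "\<forall>S\<in>\<K>. ?P S"
    then show "\<Union>\<K> \<subseteq> (\<Union>n\<in>{1..}. N n)" by blast
    fix n :: nat assume "1 \<le> n"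
    then have "openin (subtopology X (N n)) (\<Union>S\<in>\<K>. S \<inter> N n)"
      using K by (intro openin_Union) auto
    then show "openin (subtopology X (N n)) (\<Union>\<K> \<inter> N n)"
      by (simp only: Int_Union2)
  qed
  then show ?thesis
    by (simp only: inductive_limit_topology_def topology_inverse')
qed

definition homotopy_equivalence_map :: "'a topology \<Rightarrow> 'b topology \<Rightarrow> ('a \<Rightarrow> 'b) \<Rightarrow> bool" where
  "homotopy_equivalence_map X Y f \<longleftrightarrow> continuous_map X Y f \<and>
     (\<exists>g. continuous_map Y X g \<and>
        homotopic_with (\<lambda>_. True) X X (g \<circ> f) id \<and>
        homotopic_with (\<lambda>_. True) Y Y (f \<circ> g) id)"

text \<open>In the last clause the target Banach space is the model space \<open>'m\<close> of the manifold.  This is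
  no restriction: an operator of index 0 between Banach spaces exists only if they are isomorphic,
  and a nonempty manifold modelled on \<open>'m\<close> has tangent spaces isomorphic to \<open>'m\<close>.\<close>

definition fredholm_filtration ::
    "('a, 'm::banach) atlas \<Rightarrow> (nat \<Rightarrow> nat) \<Rightarrow> (nat \<Rightarrow> 'a set) \<Rightarrow> bool" where
  "fredholm_filtration A \<delta> N \<longleftrightarrow>
     banach_manifold A \<and> strict_mono_on {1..} \<delta> \<and>
     (\<forall>n\<ge>1. submanifold_dim A (\<delta> n) (N n)) \<and>
     (\<forall>n\<ge>1. N n \<subseteq> N (Suc n)) \<and>
     (\<forall>n\<ge>1. trivial_normal_bundle A (N n) (N (Suc n)) \<and>
             trivial_normal_bundle A (N n) (mcarrier A)) \<and>
     mtopology A closure_of (\<Union>n\<in>{1..}. N n) = mcarrier A \<and>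
     homotopy_equivalence_map (inductive_limit_topology (mtopology A) N) (mtopology A) id \<and>
     (\<exists>(f :: 'a \<Rightarrow> 'm) B.
        fredholm_map A banach_space_atlas f 0 \<and>
        delta_flag \<delta> B \<and>
        (\<forall>n\<ge>1. transverse_to_subspace A f (B n) \<and> N n = {x \<in> mcarrier A. f x \<in> B n}))"

section \<open>The Banach space of compact operators\<close>

definition compact_operator :: "('a::real_normed_vector \<Rightarrow>\<^sub>L 'b::real_normed_vector) \<Rightarrow> bool" where
  "compact_operator T \<longleftrightarrow> compact (closure (blinfun_apply T ` cball 0 1))"

lemma compact_operator_0: "compact_operator 0"
  by (simp add: compact_operator_def image_constant_conv)

lemma compact_operator_add:
  assumes "compact_operator S" "compact_operator T"
  shows "compact_operator (S + T)"
proof -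
  let ?A = "closure (blinfun_apply S ` cball 0 1)" and ?B = "closure (blinfun_apply T ` cball 0 1)"
  let ?K = "{x + y |x y. x \<in> ?A \<and> y \<in> ?B}"
  have K: "compact ?K"
    using assms by (intro compact_sums) (auto simp: compact_operator_def)
  have "blinfun_apply (S + T) ` cball 0 1 \<subseteq> ?K"
  proof
    fix y assume "y \<in> blinfun_apply (S + T) ` cball 0 1"
    then obtain z where z: "z \<in> cball 0 1" "y = S z + T z"
      by (auto simp: blinfun.add_left)
    moreover have "S z \<in> ?A" "T z \<in> ?B"
      using z(1) by (meson closure_subset image_eqI subsetD)+
    ultimately show "y \<in> ?K" by blast
  qed
  then have "closure (blinfun_apply (S + T) ` cball 0 1) \<subseteq> ?K"
    using K by (simp add: closure_minimal compact_imp_closed)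
  then have "closure (blinfun_apply (S + T) ` cball 0 1) = ?K \<inter> closure (blinfun_apply (S + T) ` cball 0 1)"
    by blast
  moreover have "compact (?K \<inter> closure (blinfun_apply (S + T) ` cball 0 1))"
    using K by (rule compact_Int_closed) simp
  ultimately show ?thesis
    unfolding compact_operator_def by (rule ssubst)
qed

lemma compact_operator_scaleR:
  assumes "compact_operator T"
  shows "compact_operator (r *\<^sub>R T)"
proof -
  let ?K = "(\<lambda>x. r *\<^sub>R x) ` closure (blinfun_apply T ` cball 0 1)"
  have K: "compact ?K"
    using assms by (intro compact_scaling) (auto simp: compact_operator_def)
  have "blinfun_apply (r *\<^sub>R T) ` cball 0 1 \<subseteq> ?K"
  proof
    fix y assume "y \<in> blinfun_apply (r *\<^sub>R T) ` cball 0 1"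
    then obtain z where z: "z \<in> cball 0 1" "y = r *\<^sub>R T z"
      by (auto simp: blinfun.scaleR_left)
    moreover have "T z \<in> closure (blinfun_apply T ` cball 0 1)"
      using z(1) by (meson closure_subset image_eqI subsetD)
    ultimately show "y \<in> ?K" by blast
  qed
  then have "closure (blinfun_apply (r *\<^sub>R T) ` cball 0 1) \<subseteq> ?K"
    using K by (simp add: closure_minimal compact_imp_closed)
  then have "closure (blinfun_apply (r *\<^sub>R T) ` cball 0 1) = ?K \<inter> closure (blinfun_apply (r *\<^sub>R T) ` cball 0 1)"
    by blast
  moreover have "compact (?K \<inter> closure (blinfun_apply (r *\<^sub>R T) ` cball 0 1))"
    using K by (rule compact_Int_closed) simp
  ultimately show ?thesis
    unfolding compact_operator_def by (rule ssubst)
qed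

lemma compact_operator_limit:
  fixes X :: "nat \<Rightarrow> 'a::real_normed_vector \<Rightarrow>\<^sub>L 'b::banach"
  assumes X: "\<And>n. compact_operator (X n)" and lim: "X \<longlonglongrightarrow> T"
  shows "compact_operator T"
  unfolding compact_operator_def compact_eq_totally_bounded
proof (intro conjI allI impI)
  show "complete (closure (blinfun_apply T ` cball 0 1))"
    by (simp add: complete_eq_closed)
  fix e :: real assume e: "e > 0"
  obtain n where n: "norm (X n - T) < e / 4"
    using LIMSEQ_D[OF lim, of "e/4"] e by auto
  have "\<exists>k. finite k \<and> closure (blinfun_apply (X n) ` cball 0 1) \<subseteq> (\<Union>x\<in>k. ball x (e / 4))"
    using X[of n] e unfolding compact_operator_def compact_eq_totally_bounded
    by (meson divide_pos_pos zero_less_numeral)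
  then obtain k where k: "finite k"
      "closure (blinfun_apply (X n) ` cball 0 1) \<subseteq> (\<Union>x\<in>k. ball x (e / 4))"
    by blast
  have "closure (blinfun_apply T ` cball 0 1) \<subseteq> (\<Union>x\<in>k. ball x e)"
  proof
    fix y assume "y \<in> closure (blinfun_apply T ` cball 0 1)"
    then obtain z where z: "norm z \<le> 1" "dist (T z) y < e / 4"
      using e by (auto simp: closure_approachable dest!: spec[where x = "e/4"])
    have "X n z \<in> closure (blinfun_apply (X n) ` cball 0 1)"
      using z(1) by (intro subsetD[OF closure_subset]) auto
    then obtain x where x: "x \<in> k" "dist x (X n z) < e / 4"
      using k by auto
    have "norm ((X n - T) z) \<le> norm (X n - T) * norm z"
      by (rule norm_blinfun)
    also have "\<dots> \<le> norm (X n - T) * 1"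
      using z by (intro mult_left_mono) auto
    finally have "dist (X n z) (T z) < e / 4"
      using n by (simp add: dist_norm blinfun.diff_left)
    then have "dist x y < e"
      using x z e dist_triangle[of x y "X n z"] dist_triangle[of "X n z" y "T z"] by linarith
    then show "y \<in> (\<Union>x\<in>k. ball x e)"
      using x by auto
  qed
  then show "\<exists>k. finite k \<and> closure (blinfun_apply T ` cball 0 1) \<subseteq> (\<Union>x\<in>k. ball x e)"
    using k by blast
qed

typedef (overloaded) 'e compact_op = "{T :: 'e::banach \<Rightarrow>\<^sub>L 'e. compact_operator T}"
  morphisms op_of Compact_op
  using compact_operator_0 by blast

lemma compact_op_of [simp]: "compact_operator (op_of K)"
  using op_of by blast

instantiation compact_op :: (banach) real_normed_vector
begin

definition "0 = Compact_op 0"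
definition "K + L = Compact_op (op_of K + op_of L)"
definition "- K = Compact_op (- op_of K)"
definition "K - L = Compact_op (op_of K - op_of L)"
definition "r *\<^sub>R K = Compact_op (r *\<^sub>R op_of K)"
definition "norm K = norm (op_of K)"
definition "sgn K = inverse (norm K) *\<^sub>R K" for K :: "'a compact_op"
definition "dist K L = norm (K - L)" for K L :: "'a compact_op"
definition "uniformity =
  (INF e\<in>{0<..}. principal {(K :: 'a compact_op, L). dist K L < e})"
definition "open (S :: 'a compact_op set) \<longleftrightarrow>
  (\<forall>K\<in>S. \<forall>\<^sub>F (K', L) in uniformity. K' = K \<longrightarrow> L \<in> S)"

lemma op_of_simps [simp]:
  "op_of 0 = 0"
  "op_of (K + L) = op_of K + op_of L"
  "op_of (- K) = - op_of K"
  "op_of (K - L) = op_of K - op_of L"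
  "op_of (r *\<^sub>R K) = r *\<^sub>R op_of K"
proof -
  have minus: "compact_operator (- op_of J)" for J :: "'a compact_op"
    using compact_operator_scaleR[of "op_of J" "- 1"] by simp
  show "op_of (0 :: 'a compact_op) = 0"
    by (simp add: zero_compact_op_def Compact_op_inverse compact_operator_0)
  show "op_of (K + L) = op_of K + op_of L"
    by (simp add: plus_compact_op_def Compact_op_inverse compact_operator_add)
  show "op_of (- K) = - op_of K"
    by (simp add: uminus_compact_op_def Compact_op_inverse minus)
  show "op_of (K - L) = op_of K - op_of L"
    using compact_operator_add[OF compact_op_of[of K] minus[of L]]
    by (simp add: minus_compact_op_def Compact_op_inverse)
  show "op_of (r *\<^sub>R K) = r *\<^sub>R op_of K"
    by (simp add: scaleR_compact_op_def Compact_op_inverse compact_operator_scaleR)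
qed

instance
proof
  fix K L J :: "'a compact_op" and r s :: real
  have eqI: "K = L" if "op_of K = op_of L" for K L :: "'a compact_op"
    using that by (simp add: op_of_inject)
  show "K + L + J = K + (L + J)" "K + L = L + K" "0 + K = K" "- K + K = 0" "K - L = K + - L"
    by (rule eqI, simp add: add_ac)+
  show "r *\<^sub>R (K + L) = r *\<^sub>R K + r *\<^sub>R L" "(r + s) *\<^sub>R K = r *\<^sub>R K + s *\<^sub>R K"
    "r *\<^sub>R s *\<^sub>R K = (r * s) *\<^sub>R K" "1 *\<^sub>R K = K"
    by (rule eqI, simp add: scaleR_add_left scaleR_add_right)+
  have "K = 0 \<longleftrightarrow> op_of K = 0"
    using eqI[of K 0] by auto
  then show "norm K = 0 \<longleftrightarrow> K = 0"
    by (simp add: norm_compact_op_def)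
  show "norm (K + L) \<le> norm K + norm L" "norm (r *\<^sub>R K) = \<bar>r\<bar> * norm K"
    by (simp_all add: norm_compact_op_def norm_triangle_ineq)
  show "dist K L = norm (K - L)"
    by (rule dist_compact_op_def)
  show "sgn K = inverse (norm K) *\<^sub>R K"
    by (rule sgn_compact_op_def)
next
  show "uniformity = (INF e\<in>{0<..}. principal {(K :: 'a compact_op, L). dist K L < e})"
    by (rule uniformity_compact_op_def)
next
  fix S :: "'a compact_op set"
  show "open S \<longleftrightarrow> (\<forall>K\<in>S. \<forall>\<^sub>F (K', L) in uniformity. K' = K \<longrightarrow> L \<in> S)"
    by (rule open_compact_op_def)
qed

end

instance compact_op :: (banach) banach
proof
  fix X :: "nat \<Rightarrow> 'a compact_op" assume "Cauchy X"
  then have "Cauchy (\<lambda>n. op_of (X n))"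
    by (simp add: Cauchy_def dist_norm norm_compact_op_def)
  then obtain T where T: "(\<lambda>n. op_of (X n)) \<longlonglongrightarrow> T"
    using Cauchy_convergent_iff convergent_def by blast
  then have "compact_operator T"
    by (rule compact_operator_limit[rotated]) simp
  then have "X \<longlonglongrightarrow> Compact_op T"
    using T by (simp add: LIMSEQ_iff norm_compact_op_def Compact_op_inverse)
  then show "convergent X"
    by (auto simp: convergent_def)
qed

section \<open>Bases and general linear groups\<close>

text \<open>Bases are indexed from 0, so \<open>head_space e n\<close> is spanned by the first \<open>n\<close> basis
  vectors and \<open>tail_space e n\<close> is the closed span of the remaining ones.\<close>

definition schauder_basis :: "(nat \<Rightarrow> 'e::real_normed_vector) \<Rightarrow> bool" where
  "schauder_basis e \<longleftrightarrow> (\<forall>x. \<exists>!a :: nat \<Rightarrow> real. (\<lambda>i. a i *\<^sub>R e i) sums x)"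

definition head_space :: "(nat \<Rightarrow> 'e::real_normed_vector) \<Rightarrow> nat \<Rightarrow> 'e set" where
  "head_space e n = span (e ` {..<n})"

definition tail_space :: "(nat \<Rightarrow> 'e::real_normed_vector) \<Rightarrow> nat \<Rightarrow> 'e set" where
  "tail_space e n = closure (span (e ` {n..}))"

definition restricted_norm :: "('e::real_normed_vector \<Rightarrow>\<^sub>L real) \<Rightarrow> 'e set \<Rightarrow> real" where
  "restricted_norm f V = (SUP v\<in>{v \<in> V. norm v \<le> 1}. \<bar>f v\<bar>)"

definition shrinking_basis :: "(nat \<Rightarrow> 'e::real_normed_vector) \<Rightarrow> bool" where
  "shrinking_basis e \<longleftrightarrow> schauder_basis e \<and>
     (\<forall>f. (\<lambda>n. restricted_norm f (tail_space e n)) \<longlonglongrightarrow> 0)"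

definition GL :: "('e::real_normed_vector \<Rightarrow>\<^sub>L 'e) set" where
  "GL = {T. \<exists>S. T o\<^sub>L S = id_blinfun \<and> S o\<^sub>L T = id_blinfun}"

definition GL_fin :: "(nat \<Rightarrow> 'e::real_normed_vector) \<Rightarrow> nat \<Rightarrow> ('e \<Rightarrow>\<^sub>L 'e) set" where
  "GL_fin e n = {T \<in> GL. blinfun_apply T ` head_space e n \<subseteq> head_space e n \<and>
     (\<forall>x\<in>tail_space e n. T x = x)}"

definition GL_K :: "('e::real_normed_vector \<Rightarrow>\<^sub>L 'e) set" where
  "GL_K = {T \<in> GL. compact_operator (T - id_blinfun)}"

definition GL_K_atlas :: "('e::banach \<Rightarrow>\<^sub>L 'e, 'e compact_op) atlas" where
  "GL_K_atlas = {(GL_K, \<lambda>T. Compact_op (T - id_blinfun))}"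

end

theory Submission
  imports Defs
begin

text \<open>
  Let \<open>P\<^sub>n\<close> be the basis projection onto \<open>head_space e n\<close> along \<open>tail_space e n\<close>, and compress an
  operator \<open>K\<close> to its leading \<open>n \<times> n\<close> block \<open>c\<^sub>n K = P\<^sub>n K P\<^sub>n\<close>.  The chart \<open>T \<mapsto> T - I\<close> identifies \<open>GL_K\<close>
  with an open subset \<open>W\<close> of the space of compact operators, and an invertible operator \<open>T\<close> belongs to
  \<open>GL_fin e n\<close> exactly when \<open>c\<^sub>n\<close> fixes \<open>T - I\<close> (lemma \<open>GL_fin_eq\<close>).  Hence the filtration is the trace
  on \<open>W\<close> of the linear flag \<open>B\<^sub>n = {K. c\<^sub>n K = K}\<close>, whose terms have dimension \<open>n\<^sup>2\<close>.  The Fredholm map is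
  the chart itself: its differential is the identity, so it has index 0 and is transverse to every
  complemented subspace.  All tangent spaces are constant in the chart, and \<open>v \<mapsto> v - c\<^sub>n v\<close> trivialises
  the normal bundles.  The complements \<open>{K. c\<^sub>n K = 0}\<close> decrease because \<open>c\<^sub>m c\<^sub>n = c\<^sub>m\<close> for \<open>m \<le> n\<close>.
  This geometric part is \<open>global_chart_fredholm_filtration\<close>.

  The analytic content is that \<open>c\<^sub>n K\<close> converges to \<open>K\<close> for every compact \<open>K\<close>
  (\<open>compact_compose_basis_proj_tendsto\<close>), with \<open>c\<^sub>n\<close> bounded uniformly in \<open>n\<close>
  (\<open>basis_proj_bounded\<close>).  The uniform bound comes from the Baire category theorem.  Given the bound,
  \<open>P\<^sub>n\<close> converges to the identity uniformly on compact sets, so \<open>P\<^sub>n K \<rightarrow> K\<close> in norm.  For \<open>K P\<^sub>n \<rightarrow> K\<close> one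
  may therefore replace \<open>K\<close> by the finite-rank operator \<open>P\<^sub>m K\<close>, and the claim becomes \<open>f P\<^sub>n \<rightarrow> f\<close> for
  finitely many functionals \<open>f\<close>, which is what a shrinking basis provides.

  The convergence gives density of the filtration.  It also gives the homotopy equivalence
  (\<open>inductive_limit_inclusion_homotopy_equivalence\<close>), by an argument of Palais: a locally finite convex
  combination \<open>g(x) = \<Sum>\<^sub>n w\<^sub>n(x) R\<^sub>n x\<close> of the approximations \<open>R\<^sub>n x = I + c\<^sub>n (x - I)\<close> stays so close to \<open>x\<close>
  that the segment from \<open>g(x)\<close> to \<open>x\<close> lies in \<open>GL_K\<close>, and it lies in a finite stage whenever \<open>x\<close> does.
  The straight-line homotopies show that \<open>g\<close> is a homotopy inverse of the inclusion; the one on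
  the inductive limit is continuous because the unit interval is locally compact.
\<close>

section \<open>Inductive limits of increasing sequences of subspaces\<close>

lemma topspace_inductive_limit_topology:
  assumes "\<And>n. n \<ge> 1 \<Longrightarrow> N n \<subseteq> topspace Y"
  shows "topspace (inductive_limit_topology Y N) = (\<Union>n\<in>{1..}. N n)"
proof -
  have "openin (subtopology Y (N n)) ((\<Union>n\<in>{1..}. N n) \<inter> N n)" if "n \<ge> 1" for n
  proof -
    have "(\<Union>n\<in>{1..}. N n) \<inter> N n = N n"
      using that by auto
    moreover have "topspace (subtopology Y (N n)) = N n"
      using assms[OF that] by auto
    ultimately show ?thesis
      by (metis openin_topspace)
  qed
  then have "openin (inductive_limit_topology Y N) (\<Union>n\<in>{1..}. N n)"
    by (simp add: openin_inductive_limit_topology)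
  then show ?thesis
    by (meson openin_inductive_limit_topology openin_subset openin_topspace subset_antisym)
qed

lemma increasing_from_one:
  fixes B :: "nat \<Rightarrow> 'a set"
  assumes inc: "\<And>n. n \<ge> 1 \<Longrightarrow> B n \<subseteq> B (Suc n)" and k: "1 \<le> k" "k \<le> n"
  shows "B k \<subseteq> B n"
  using k(2)
proof (induction n rule: dec_induct)
  case (step m)
  then have "B m \<subseteq> B (Suc m)"
    using inc[of m] k(1) by linarith
  with step.IH show ?case by (rule subset_trans)
qed simp

text \<open>The inclusion of each stage into the inductive limit is continuous, so a map that locally takes
  values in a single stage, and is continuous there, is continuous into the limit.\<close>

lemma continuous_map_into_inductive_limit:
  assumes sub: "\<And>n. n \<ge> 1 \<Longrightarrow> N n \<subseteq> topspace Y"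
    and loc: "\<And>x. x \<in> topspace X \<Longrightarrow>
      \<exists>V n. openin X V \<and> x \<in> V \<and> n \<ge> 1 \<and> continuous_map (subtopology X V) (subtopology Y (N n)) h"
  shows "continuous_map X (inductive_limit_topology Y N) h"
proof -
  have top: "topspace (inductive_limit_topology Y N) = (\<Union>n\<in>{1..}. N n)"
    by (rule topspace_inductive_limit_topology) (rule sub)
  show ?thesis
    unfolding continuous_map top
  proof (intro conjI allI impI)
    show "h ` topspace X \<subseteq> (\<Union>n\<in>{1..}. N n)"
    proof (rule image_subsetI)
      fix x assume "x \<in> topspace X"
      from loc[OF this] obtain V n where V: "openin X V" "x \<in> V" "n \<ge> 1"
        "continuous_map (subtopology X V) (subtopology Y (N n)) h" by blast
      have "x \<in> topspace (subtopology X V)"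
        using V \<open>x \<in> topspace X\<close> by simp
      then have "h x \<in> topspace (subtopology Y (N n))"
        using continuous_map_image_subset_topspace[OF V(4)] by blast
      then show "h x \<in> (\<Union>n\<in>{1..}. N n)"
        using V(3) by auto
    qed
    fix W assume W: "openin (inductive_limit_topology Y N) W"
    show "openin X {x \<in> topspace X. h x \<in> W}"
    proof (subst openin_subopen, intro ballI)
      fix x assume x: "x \<in> {x \<in> topspace X. h x \<in> W}"
      then obtain V n where V: "openin X V" "x \<in> V" "n \<ge> 1"
        and cont: "continuous_map (subtopology X V) (subtopology Y (N n)) h"
        using loc by blast
      have "openin (subtopology Y (N n)) (W \<inter> N n)"
        using W \<open>n \<ge> 1\<close> by (simp add: openin_inductive_limit_topology)
      then have "openin (subtopology X V) {y \<in> topspace (subtopology X V). h y \<in> W \<inter> N n}"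
        using cont unfolding continuous_map by blast
      then have "openin X {y \<in> topspace (subtopology X V). h y \<in> W \<inter> N n}"
        using V(1) openin_trans_full by blast
      moreover have "h y \<in> N n" if "y \<in> V" for y
        using continuous_map_image_subset_topspace[OF cont] that openin_subset[OF V(1)] by auto
      ultimately show "\<exists>T. openin X T \<and> x \<in> T \<and> T \<subseteq> {x \<in> topspace X. h x \<in> W}"
        using x V by (intro exI[of _ "{y \<in> topspace (subtopology X V). h y \<in> W \<inter> N n}"]) auto
    qed
  qed
qed

text \<open>Products do not commute with inductive limits in general, but they do when the other factor is
  locally compact: with a compact neighbourhood \<open>J\<close> in that factor, the tube lemma in each stage shows
  that the points whose whole fibre over \<open>J\<close> lies in a given open set form an open set of the limit.\<close>

lemma continuous_map_prod_inductive_limit: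
  assumes base: "neighbourhood_base_of (compactin X) X"
    and sub: "\<And>n. n \<ge> 1 \<Longrightarrow> N n \<subseteq> topspace Y"
    and cont: "\<And>n. n \<ge> 1 \<Longrightarrow> continuous_map (prod_topology X (subtopology Y (N n))) Z h"
  shows "continuous_map (prod_topology X (inductive_limit_topology Y N)) Z h"
  unfolding continuous_map
proof (intro conjI allI impI)
  have top: "topspace (inductive_limit_topology Y N) = (\<Union>n\<in>{1..}. N n)"
    by (rule topspace_inductive_limit_topology) (rule sub)
  show "h ` topspace (prod_topology X (inductive_limit_topology Y N)) \<subseteq> topspace Z"
  proof (rule image_subsetI)
    fix p assume "p \<in> topspace (prod_topology X (inductive_limit_topology Y N))"
    then obtain n where "n \<ge> 1" "p \<in> topspace (prod_topology X (subtopology Y (N n)))"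
      using sub by (fastforce simp: top)
    then show "h p \<in> topspace Z"
      using continuous_map_image_subset_topspace[OF cont] by blast
  qed
  fix W assume W: "openin Z W"
  define P where "P = {p \<in> topspace (prod_topology X (inductive_limit_topology Y N)). h p \<in> W}"
  have P: "(s, y) \<in> P \<longleftrightarrow> s \<in> topspace X \<and> y \<in> (\<Union>n\<in>{1..}. N n) \<and> h (s, y) \<in> W" for s y
    by (auto simp: P_def top)
  have openP: "openin (prod_topology X (subtopology Y (N n))) (P \<inter> (topspace X \<times> N n))" if n: "n \<ge> 1" for n
  proof -
    have "P \<inter> (topspace X \<times> N n) =
        {p \<in> topspace (prod_topology X (subtopology Y (N n))). h p \<in> W}"
      using sub[OF n] n by (auto simp: P)
    then show ?thesis
      using cont[OF n] W by (simp add: continuous_map)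
  qed
  have "\<exists>U V. openin X U \<and> openin (inductive_limit_topology Y N) V \<and> s \<in> U \<and> y \<in> V \<and> U \<times> V \<subseteq> P"
    if sy: "(s, y) \<in> P" for s y
  proof -
    obtain n where n: "n \<ge> 1" "y \<in> N n" and s: "s \<in> topspace X" and hW: "h (s, y) \<in> W"
      using sy by (auto simp: P)
    have "continuous_map X (prod_topology X (subtopology Y (N n))) (\<lambda>s. (s, y))"
      using n sub[of n] by (auto intro!: continuous_map_pairedI)
    then have "continuous_map X Z (h \<circ> (\<lambda>s. (s, y)))"
      using cont[OF n(1)] continuous_map_compose by blast
    then have "openin X {s \<in> topspace X. h (s, y) \<in> W}"
      using W by (simp add: continuous_map o_def)
    then obtain U J where U: "openin X U" "s \<in> U" "U \<subseteq> J" and J: "compactin X J"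
      and JW: "J \<subseteq> {s \<in> topspace X. h (s, y) \<in> W}"
      using base s hW unfolding neighbourhood_base_of by (metis (mono_tags, lifting) mem_Collect_eq)
    \<comment> \<open>The second factor of the neighbourhood; the tube lemma makes its trace on every stage open.\<close>
    define V where "V = {y \<in> (\<Union>n\<in>{1..}. N n). J \<times> {y} \<subseteq> P}"
    have "openin (subtopology Y (N m)) (V \<inter> N m)" if m: "m \<ge> 1" for m
    proof (subst openin_subopen, intro ballI)
      fix z assume z: "z \<in> V \<inter> N m"
      then have "J \<times> {z} \<subseteq> P \<inter> (topspace X \<times> N m)"
        using compactin_subset_topspace[OF J] by (auto simp: V_def)
      moreover have "z \<in> topspace (subtopology Y (N m))"
        using z sub[OF m] by auto
      ultimately have "\<exists>U' V'. openin X U' \<and> openin (subtopology Y (N m)) V' \<and> J \<subseteq> U' \<and> z \<in> V' \<and>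
          U' \<times> V' \<subseteq> P \<inter> (topspace X \<times> N m)"
        by (intro tube_lemma_left[OF openP[OF m] J])
      then obtain U' V' where UV: "J \<subseteq> U'" "z \<in> V'"
        "openin (subtopology Y (N m)) V'" "U' \<times> V' \<subseteq> P \<inter> (topspace X \<times> N m)"
        by blast
      have "V' \<subseteq> N m"
        using openin_subset[OF UV(3)] by auto
      then have "V' \<subseteq> V \<inter> N m"
        using UV m by (fastforce simp: V_def)
      then show "\<exists>T. openin (subtopology Y (N m)) T \<and> z \<in> T \<and> T \<subseteq> V \<inter> N m"
        using UV by blast
    qed
    then have "openin (inductive_limit_topology Y N) V"
      by (auto simp: openin_inductive_limit_topology V_def)
    moreover have "y \<in> V"
      using n JW by (auto simp: V_def P)
    moreover have "U \<times> V \<subseteq> P"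
      using U by (auto simp: V_def)
    ultimately show ?thesis
      using U by blast
  qed
  then show "openin (prod_topology X (inductive_limit_topology Y N))
      {p \<in> topspace (prod_topology X (inductive_limit_topology Y N)). h p \<in> W}"
    unfolding P_def[symmetric] openin_prod_topology_alt by blast
qed

text \<open>The map \<open>g\<close> is a convex combination of the \<open>R\<^sub>n x\<close> that uses, near each point, only finitely many
  \<open>n\<close>, and at the point \<open>x\<close> only those with \<open>R\<^sub>n x\<close> in the ball of radius \<open>r x\<close>.  Convexity of the
  ball keeps \<open>g x\<close> close to \<open>x\<close>, and convexity of \<open>B n\<close> keeps \<open>g\<close> locally inside one stage.  The
  uniform Lipschitz constant makes the supremum of the errors \<open>norm (R\<^sub>m x - x)\<close> over \<open>m \<ge> n\<close>
  continuous in \<open>x\<close>; the weights are built from it.\<close>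

lemma finite_stage_approximation:
  fixes R :: "nat \<Rightarrow> 'v::real_normed_vector \<Rightarrow> 'v" and r :: "'v \<Rightarrow> real"
  assumes lip: "\<And>n x y. \<lbrakk>x \<in> M; y \<in> M\<rbrakk> \<Longrightarrow> norm (R n x - R n y) \<le> C * norm (x - y)"
    and lim: "\<And>x. x \<in> M \<Longrightarrow> (\<lambda>n. R n x) \<longlonglongrightarrow> x"
    and RB: "\<And>n x. \<lbrakk>n \<ge> 1; x \<in> M\<rbrakk> \<Longrightarrow> R n x \<in> B n"
    and convB: "\<And>n. n \<ge> 1 \<Longrightarrow> convex (B n)"
    and incB: "\<And>n. n \<ge> 1 \<Longrightarrow> B n \<subseteq> B (Suc n)"
    and contr: "continuous_on M r" and rpos: "\<And>x. x \<in> M \<Longrightarrow> r x > 0"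
  obtains g where "\<And>x. x \<in> M \<Longrightarrow> norm (g x - x) < r x"
    "\<And>x. x \<in> M \<Longrightarrow> \<exists>V n. open V \<and> x \<in> V \<and> n \<ge> 1 \<and> g ` (M \<inter> V) \<subseteq> B n \<and> continuous_on (M \<inter> V) g"
proof -
  define d where "d n x = (SUP m\<in>{n..}. norm (R m x - x))" for n x
  have bdd: "bdd_above ((\<lambda>m. norm (R m x - x)) ` S)" if "x \<in> M" for x S
  proof -
    have "(\<lambda>n. norm (R n x - x)) \<longlonglongrightarrow> norm (x - x)"
      by (intro tendsto_intros lim that)
    then have "Bseq (\<lambda>n. norm (R n x - x))"
      by (rule convergent_imp_Bseq[OF convergentI])
    then obtain K where "\<And>n. norm (R n x - x) \<le> K"
      unfolding Bseq_def by auto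
    then show ?thesis
      by (auto simp: bdd_above_def)
  qed
  have d_ge: "norm (R m x - x) \<le> d n x" if "m \<ge> n" "x \<in> M" for m n x
    unfolding d_def using that by (intro cSUP_upper bdd) auto
  have d_anti: "d m x \<le> d n x" if "m \<ge> n" "x \<in> M" for m n x
    unfolding d_def by (rule cSUP_subset_mono) (use that in \<open>auto intro: bdd\<close>)
  have d_lip: "d n x \<le> d n y + (C + 1) * norm (x - y)" if "x \<in> M" "y \<in> M" for n x y
    unfolding d_def[of n x]
  proof (rule cSUP_least)
    fix m assume "m \<in> {n..}"
    have "norm (R m x - x) = norm ((R m x - R m y) + (R m y - y) - (x - y))"
      by simp
    also have "\<dots> \<le> norm (R m x - R m y) + norm (R m y - y) + norm (x - y)"
      by (meson add_mono norm_triangle_ineq norm_triangle_ineq4 order_refl order_trans)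
    also have "\<dots> \<le> C * norm (x - y) + d n y + norm (x - y)"
      using d_ge[of n m y] lip that \<open>m \<in> {n..}\<close> by (intro add_mono) auto
    finally show "norm (R m x - x) \<le> d n y + (C + 1) * norm (x - y)"
      by (simp add: algebra_simps)
  qed simp
  have d_cont: "continuous_on M (d n)" for n
  proof (rule lipschitz_on_continuous_on[OF lipschitz_onI])
    show "0 \<le> \<bar>C + 1\<bar>" by simp
    fix x y assume xy: "x \<in> M" "y \<in> M"
    have "(C + 1) * norm (x - y) \<le> \<bar>C + 1\<bar> * norm (x - y)"
      by (intro mult_right_mono) auto
    then show "dist (d n x) (d n y) \<le> \<bar>C + 1\<bar> * dist x y"
      using d_lip[OF xy, of n] d_lip[OF xy(2,1), of n]
      by (simp add: dist_norm norm_minus_commute abs_le_iff)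
  qed
  have d_small: "\<exists>n\<ge>1. d n x < \<epsilon>" if xe: "x \<in> M" "\<epsilon> > 0" for x \<epsilon>
  proof -
    obtain n where n: "\<And>m. m \<ge> n \<Longrightarrow> norm (R m x - x) < \<epsilon> / 2"
      using LIMSEQ_D[OF lim[OF xe(1)], of "\<epsilon> / 2"] xe(2) by auto
    then have "d (max 1 n) x \<le> \<epsilon> / 2"
      unfolding d_def by (intro cSUP_least) (auto intro: less_imp_le)
    then show ?thesis
      using xe(2) by (intro exI[of _ "max 1 n"]) auto
  qed
  \<comment> \<open>The cut-off \<open>c n\<close> decreases in \<open>n\<close> from 1 to 0.  It is 1 while the tail error is at least \<open>r x\<close>, and
    0 once the tail error is at most half of \<open>r x\<close>.\<close>
  define c where "c n x = (if n = 0 then 1 else max 0 (min 1 (2 * (d n x / r x) - 1)))" for n x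
  have c_anti: "c (Suc n) x \<le> c n x" if "x \<in> M" for n x
  proof (cases "n = 0")
    case False
    have "d (Suc n) x / r x \<le> d n x / r x"
      using d_anti[of n "Suc n" x] rpos[OF that] that by (intro divide_right_mono) auto
    then show ?thesis
      using False by (simp add: c_def)
  qed (simp add: c_def)
  have c_cont: "continuous_on M (c n)" for n
  proof (cases "n = 0")
    case False
    have "continuous_on M (\<lambda>x. max 0 (min 1 (2 * (d n x / r x) - 1)))"
      using rpos by (intro continuous_intros d_cont contr) (metis less_irrefl)
    then show ?thesis
      using False by (simp add: c_def[abs_def])
  qed (simp add: c_def[abs_def])
  \<comment> \<open>The differences of the cut-offs are nonnegative with telescoping sum 1.  The weight \<open>w n\<close> belongs
    to \<open>R (Suc n)\<close>, so that only indices from 1 on occur; \<open>w n x \<noteq> 0\<close> forces \<open>c (Suc n) x < 1\<close>.\<close>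
  define w where "w n x = c n x - c (Suc n) x" for n x
  have w_nonneg: "w n x \<ge> 0" if "x \<in> M" for n x
    using c_anti[OF that] by (simp add: w_def)
  have w_pos: "norm (R (Suc n) x - x) < r x" if "x \<in> M" "w n x \<noteq> 0" for n x
  proof -
    have "c n x \<le> 1"
      by (auto simp: c_def)
    then have "c (Suc n) x < 1"
      using w_nonneg[OF that(1), of n] that(2) by (auto simp: w_def)
    then have "2 * (d (Suc n) x / r x) - 1 < 1"
      by (simp add: c_def min_less_iff_disj)
    then have "d (Suc n) x < r x"
      using rpos[OF that(1)] by (simp add: divide_less_eq)
    then show ?thesis
      using d_ge[of "Suc n" "Suc n" x] that by simp
  qed
  have w_sum: "(\<Sum>n<m. w n x) = 1 - c m x" for m x
    by (induction m) (simp_all add: w_def, simp add: c_def)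
  \<comment> \<open>The number of summands depends on \<open>x\<close>, but by \<open>g_eq\<close> any index with \<open>c m x = 0\<close> may replace
    \<open>K x\<close>; a common one exists near every point.\<close>
  define K where "K x = (LEAST n. c n x = 0)" for x
  define g where "g x = (\<Sum>n<K x. w n x *\<^sub>R R (Suc n) x)" for x
  have g_eq: "g x = (\<Sum>n<m. w n x *\<^sub>R R (Suc n) x)" if "x \<in> M" "c m x = 0" for x m
  proof -
    have cK: "c (K x) x = 0"
      unfolding K_def by (rule LeastI, rule that(2))
    have "K x \<le> m"
      unfolding K_def by (rule Least_le, rule that(2))
    moreover have "w n x = 0" if "n \<ge> K x" for n
    proof -
      have "c n x \<le> c (K x) x" if "n \<ge> K x" for n
        using that by (induction n rule: dec_induct) (use c_anti[OF \<open>x \<in> M\<close>] order_trans in blast)+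
      moreover have "c n x \<ge> 0" for n
        by (simp add: c_def)
      ultimately have "c n x = 0" if "n \<ge> K x" for n
        using cK that by (metis order_antisym)
      then show ?thesis
        using that by (simp add: w_def)
    qed
    ultimately show ?thesis
      unfolding g_def by (intro sum.mono_neutral_left) auto
  qed
  have g_in: "g x \<in> S" if "x \<in> M" "c m x = 0" "convex S"
      "\<And>n. n < m \<Longrightarrow> w n x \<noteq> 0 \<Longrightarrow> R (Suc n) x \<in> S" for x m S
  proof -
    let ?I = "{n. n < m \<and> w n x \<noteq> 0}"
    have "g x = (\<Sum>n\<in>?I. w n x *\<^sub>R R (Suc n) x)"
      unfolding g_eq[OF that(1,2)] by (rule sum.mono_neutral_right) auto
    moreover have "(\<Sum>n\<in>?I. w n x) = (\<Sum>n<m. w n x)"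
      by (rule sum.mono_neutral_left) auto
    moreover have "(\<Sum>n\<in>?I. w n x *\<^sub>R R (Suc n) x) \<in> S"
      if "(\<Sum>n\<in>?I. w n x) = 1"
      by (rule convex_sum[OF _ \<open>convex S\<close> that])
        (use w_nonneg[OF \<open>x \<in> M\<close>] \<open>\<And>n. n < m \<Longrightarrow> w n x \<noteq> 0 \<Longrightarrow> R (Suc n) x \<in> S\<close> in auto)
    ultimately show ?thesis
      using w_sum[where m = m and x = x] that(2) by simp
  qed
  have c_zero: "\<exists>V n. open V \<and> x \<in> V \<and> n \<ge> 1 \<and> (\<forall>y\<in>M \<inter> V. c n y = 0)" if x: "x \<in> M" for x
  proof -
    obtain n where n: "n \<ge> 1" "d n x < r x / 2"
      using d_small[OF x, of "r x / 2"] rpos[OF x] by auto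
    have "continuous_on M (\<lambda>y. d n y - r y / 2)"
      by (intro continuous_intros d_cont contr) simp_all
    then have "openin (top_of_set M) (M \<inter> (\<lambda>y. d n y - r y / 2) -` {..<0})"
      by (rule continuous_openin_preimage_gen) simp
    then obtain V where V: "open V" "M \<inter> (\<lambda>y. d n y - r y / 2) -` {..<0} = M \<inter> V"
      by (auto simp: openin_open)
    have "c n y = 0" if "y \<in> M \<inter> V" for y
    proof -
      have "d n y < r y / 2"
        using that V(2) by (auto simp: set_eq_iff)
      then show ?thesis
        using n(1) rpos[of y] that by (auto simp: c_def field_simps max_def min_def)
    qed
    moreover have "x \<in> V"
      using V(2) n x by (auto simp: set_eq_iff)
    ultimately show ?thesis
      using n V by blast
  qed
  show thesis
  proof
    fix x assume x: "x \<in> M"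
    obtain V n where V: "open V" "x \<in> V" "n \<ge> 1" "\<forall>y\<in>M \<inter> V. c n y = 0"
      using c_zero[OF x] by blast
    have "g x \<in> ball x (r x)"
      using V x w_pos[OF x]
      by (intro g_in[where m = n]) (auto simp: dist_norm norm_minus_commute)
    then show "norm (g x - x) < r x"
      by (simp add: dist_norm norm_minus_commute)
    have "B k \<subseteq> B n" if "1 \<le> k" "k \<le> n" for k
      using increasing_from_one[of B k n] incB that by blast
    then have stage: "R (Suc k) y \<in> B n" if "y \<in> M" "k < n" for k y
      using RB[of "Suc k" y] that by (metis Suc_leI le_add1 plus_1_eq_Suc subsetD)
    have "g y \<in> B n" if "y \<in> M \<inter> V" for y
      using V stage that by (intro g_in[where m = n] convB) auto
    moreover have "continuous_on (M \<inter> V) g"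
    proof (rule continuous_on_eq)
      have "continuous_on M (R k)" for k
      proof (rule lipschitz_on_continuous_on[OF lipschitz_onI])
        show "0 \<le> \<bar>C\<bar>" by simp
        fix x y assume xy: "x \<in> M" "y \<in> M"
        have "C * norm (x - y) \<le> \<bar>C\<bar> * norm (x - y)"
          by (intro mult_right_mono) auto
        then show "dist (R k x) (R k y) \<le> \<bar>C\<bar> * dist x y"
          using lip[OF xy, of k] by (simp add: dist_norm)
      qed
      then have "continuous_on M (\<lambda>y. \<Sum>k<n. w k y *\<^sub>R R (Suc k) y)"
        unfolding w_def by (intro continuous_intros c_cont)
      then show "continuous_on (M \<inter> V) (\<lambda>y. \<Sum>k<n. w k y *\<^sub>R R (Suc k) y)"
        by (rule continuous_on_subset) auto
      show "(\<Sum>k<n. w k y *\<^sub>R R (Suc k) y) = g y" if "y \<in> M \<inter> V" for y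
        using V(4) that g_eq[of y n] by auto
    qed
    ultimately show "\<exists>V n. open V \<and> x \<in> V \<and> n \<ge> 1 \<and> g ` (M \<inter> V) \<subseteq> B n \<and> continuous_on (M \<inter> V) g"
      using V by blast
  qed
qed

text \<open>The affine setting \<open>M = A \<inter> U\<close> fits \<open>GL_K\<close>, which is open in the set \<open>A\<close> of compact
  perturbations of the identity and not in the space of all operators.\<close>

lemma inductive_limit_inclusion_homotopy_equivalence:
  fixes R :: "nat \<Rightarrow> 'v::real_normed_vector \<Rightarrow> 'v"
  assumes M: "M = A \<inter> U" and U: "open U" and convA: "convex A"
    and B: "\<And>n. n \<ge> 1 \<Longrightarrow> convex (B n) \<and> B n \<subseteq> A \<and> B n \<subseteq> B (Suc n)"
    and N: "\<And>n. n \<ge> 1 \<Longrightarrow> N n = M \<inter> B n"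
    and lip: "\<And>n x y. \<lbrakk>x \<in> A; y \<in> A\<rbrakk> \<Longrightarrow> norm (R n x - R n y) \<le> C * norm (x - y)"
    and lim: "\<And>x. x \<in> A \<Longrightarrow> (\<lambda>n. R n x) \<longlonglongrightarrow> x"
    and RB: "\<And>n x. \<lbrakk>n \<ge> 1; x \<in> A\<rbrakk> \<Longrightarrow> R n x \<in> B n"
  shows "homotopy_equivalence_map (inductive_limit_topology (top_of_set M) N) (top_of_set M) id"
proof -
  \<comment> \<open>The distance to the complement of \<open>U\<close>; \<open>infdist\<close> to the empty set is 0, hence the case split.\<close>
  define r where "r x = (if U = UNIV then 1 else infdist x (- U))" for x
  have r_cont: "continuous_on S r" for S
    unfolding r_def[abs_def] by (cases "U = UNIV") (auto intro: continuous_intros)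
  have r_pos: "r x > 0" if "x \<in> M" for x
  proof (cases "U = UNIV")
    case False
    then have "x \<in> - U \<longleftrightarrow> infdist x (- U) = 0"
      using U by (intro in_closed_iff_infdist_zero) auto
    then show ?thesis
      using that M False infdist_nonneg[of x "- U"] by (auto simp: r_def)
  qed (simp add: r_def)
  have r_ball: "ball x (r x) \<subseteq> U" for x
  proof
    fix y assume "y \<in> ball x (r x)"
    then show "y \<in> U"
      using infdist_le[of y "- U" x] by (cases "U = UNIV") (auto simp: r_def)
  qed
  obtain g where g_near: "\<And>x. x \<in> M \<Longrightarrow> norm (g x - x) < r x"
    and g_loc: "\<And>x. x \<in> M \<Longrightarrow>
      \<exists>V n. open V \<and> x \<in> V \<and> n \<ge> 1 \<and> g ` (M \<inter> V) \<subseteq> B n \<and> continuous_on (M \<inter> V) g"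
  proof (rule finite_stage_approximation[of M R C B r])
    show "norm (R n x - R n y) \<le> C * norm (x - y)" if "x \<in> M" "y \<in> M" for n x y
      using lip that M by simp
    show "(\<lambda>n. R n x) \<longlonglongrightarrow> x" if "x \<in> M" for x
      using lim that M by simp
    show "R n x \<in> B n" if "n \<ge> 1" "x \<in> M" for n x
      using RB that M by simp
    show "convex (B n)" "B n \<subseteq> B (Suc n)" if "n \<ge> 1" for n
      using B that by simp_all
  qed (use r_cont r_pos in auto)
  have B_mono: "B k \<subseteq> B n" if "1 \<le> k" "k \<le> n" for k n
    using increasing_from_one[of B k n] B that by blast
  \<comment> \<open>This one formula serves for both homotopies, on \<open>M\<close> and on the inductive limit.\<close>
  define H where "H = (\<lambda>(s, x). (1 - s) *\<^sub>R g x + s *\<^sub>R x)"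
  have H_in: "H (s, x) \<in> M" if s: "s \<in> {0..1}" and x: "x \<in> M" for s x
  proof -
    have "g x \<in> A"
      using g_loc[OF x] B x by fastforce
    then have "H (s, x) \<in> A"
      using convexD[OF convA, of "g x" x "1 - s" s] s x M by (simp add: H_def)
    moreover have "H (s, x) \<in> ball x (r x)"
      using convexD[OF convex_ball, of "g x" x "r x" x "1 - s" s] s g_near[OF x] r_pos[OF x]
      by (simp add: H_def dist_norm norm_minus_commute)
    ultimately show ?thesis
      using r_ball M by blast
  qed
  have H_stage: "H (s, x) \<in> N (max k n)"
    if s: "s \<in> {0..1}" and x: "x \<in> N k" and k: "k \<ge> 1" and n: "n \<ge> 1" "g x \<in> B n" for s x k n
  proof -
    have "x \<in> M" "x \<in> B (max k n)" "g x \<in> B (max k n)"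
      using x n B_mono[OF k, of "max k n"] B_mono[of n "max k n"] N[OF k] by auto
    moreover have "convex (B (max k n))"
      using B k by simp
    ultimately have "H (s, x) \<in> B (max k n)"
      using convexD[of "B (max k n)" "g x" x "1 - s" s] s by (simp add: H_def)
    then show ?thesis
      using H_in[OF s \<open>x \<in> M\<close>] N[of "max k n"] k by simp
  qed
  have sub: "N n \<subseteq> topspace (top_of_set M)" if "n \<ge> 1" for n
    using N[OF that] by simp
  have top: "topspace (inductive_limit_topology (top_of_set M) N) = (\<Union>n\<in>{1..}. N n)"
    by (rule topspace_inductive_limit_topology) (rule sub)
  have sub_eq: "subtopology (top_of_set M) (N n) = top_of_set (N n)" if "n \<ge> 1" for n
    using N[OF that] by (simp add: subtopology_subtopology Int_absorb1)
  have g_cont: "continuous_map (top_of_set M) (inductive_limit_topology (top_of_set M) N) g"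
  proof (rule continuous_map_into_inductive_limit[OF sub])
    fix x assume "x \<in> topspace (top_of_set M)"
    then have x: "x \<in> M" by simp
    obtain V n where V: "open V" "x \<in> V" "n \<ge> 1" "g ` (M \<inter> V) \<subseteq> B n" "continuous_on (M \<inter> V) g"
      using g_loc[OF x] by blast
    have "g ` (M \<inter> V) \<subseteq> N n"
      using V(4) H_in[of 0] N[OF V(3)] by (auto simp: H_def)
    then have "continuous_map (subtopology (top_of_set M) (M \<inter> V)) (subtopology (top_of_set M) (N n)) g"
      using V(5) N[OF V(3)] by (auto simp: sub_eq[OF V(3)] subtopology_subtopology)
    then show "\<exists>V n. openin (top_of_set M) V \<and> x \<in> V \<and> n \<ge> 1 \<and>
        continuous_map (subtopology (top_of_set M) V) (subtopology (top_of_set M) (N n)) g"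
      using V x by (intro exI[of _ "M \<inter> V"] exI[of _ n]) (auto intro: openin_open_Int)
  qed
  have id_cont: "continuous_map (inductive_limit_topology (top_of_set M) N) (top_of_set M) id"
    unfolding continuous_map top
  proof (intro conjI allI impI)
    show "id ` (\<Union>n\<in>{1..}. N n) \<subseteq> topspace (top_of_set M)"
      using N by auto
    fix W assume W: "openin (top_of_set M) W"
    have "openin (subtopology (top_of_set M) (N n)) ({x \<in> \<Union>n\<in>{1..}. N n. id x \<in> W} \<inter> N n)"
      if "n \<ge> 1" for n
    proof -
      have "{x \<in> \<Union>n\<in>{1..}. N n. id x \<in> W} \<inter> N n = W \<inter> N n"
        using that by auto
      then show ?thesis
        using W by (metis openin_subtopology)
    qed
    then show "openin (inductive_limit_topology (top_of_set M) N) {x \<in> \<Union>n\<in>{1..}. N n. id x \<in> W}"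
      by (auto simp: openin_inductive_limit_topology)
  qed
  have g_contM: "continuous_on M g"
    using continuous_map_compose[OF g_cont id_cont] by simp
  have H_cont: "continuous_on ({0..1} \<times> M) H"
    unfolding H_def case_prod_unfold
    by (intro continuous_intros continuous_on_compose2[OF g_contM]) auto
  have "homotopic_with (\<lambda>_. True) (top_of_set M) (top_of_set M) (id \<circ> g) id"
    unfolding homotopic_with_def
  proof (intro exI[of _ H] conjI allI ballI)
    show "continuous_map (prod_topology (top_of_set {0..1}) (top_of_set M)) (top_of_set M) H"
      using H_cont H_in by auto
  qed (simp_all add: H_def)
  moreover have "homotopic_with (\<lambda>_. True) (inductive_limit_topology (top_of_set M) N)
      (inductive_limit_topology (top_of_set M) N) (g \<circ> id) id"
    unfolding homotopic_with_def
  proof (intro exI[of _ H] conjI allI ballI)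
    show "continuous_map (prod_topology (top_of_set {0..1}) (inductive_limit_topology (top_of_set M) N))
        (inductive_limit_topology (top_of_set M) N) H"
    proof (rule continuous_map_prod_inductive_limit[OF _ sub])
      show "neighbourhood_base_of (compactin (top_of_set {0..1::real})) (top_of_set {0..1})"
        by (intro locally_compact_imp_neighbourhood_base compact_imp_locally_compact_space
            metrizable_imp_regular_space metrizable_space_subtopology metrizable_space_euclidean)
          (simp add: compact_space_subtopology)
      fix k :: nat assume k: "k \<ge> 1"
      show "continuous_map (prod_topology (top_of_set {0..1}) (subtopology (top_of_set M) (N k)))
          (inductive_limit_topology (top_of_set M) N) H"
        unfolding sub_eq[OF k] prod_topology_subtopology_eu
      proof (rule continuous_map_into_inductive_limit[OF sub])
        fix p assume "p \<in> topspace (top_of_set ({0..1::real} \<times> N k))"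
        then obtain s x where p: "p = (s, x)" "s \<in> {0..1}" "x \<in> N k" by auto
        then have x: "x \<in> M"
          using N[OF k] by simp
        obtain V n where V: "open V" "x \<in> V" "n \<ge> 1" "g ` (M \<inter> V) \<subseteq> B n"
          using g_loc[OF x] by blast
        let ?P = "{0..1::real} \<times> (N k \<inter> V)"
        have "H ` ?P \<subseteq> N (max k n)"
          using H_stage[OF _ _ k V(3)] V(4) N[OF k] by fastforce
        moreover have "continuous_on ?P H"
          using H_cont by (rule continuous_on_subset) (use N[OF k] in auto)
        moreover have "?P = ({0..1} \<times> N k) \<inter> (UNIV \<times> V)" by auto
        then have "openin (top_of_set ({0..1} \<times> N k)) ?P"
          using V(1) by (auto intro!: openin_open_Int open_Times)
        moreover have "subtopology (top_of_set ({0..1} \<times> N k)) ?P = top_of_set ?P"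
          by (simp add: subtopology_subtopology Int_absorb1 Sigma_mono)
        moreover have "subtopology (top_of_set M) (N (max k n)) = top_of_set (N (max k n))"
          using k by (intro sub_eq) simp
        ultimately show "\<exists>V n. openin (top_of_set ({0..1} \<times> N k)) V \<and> p \<in> V \<and> n \<ge> 1 \<and>
            continuous_map (subtopology (top_of_set ({0..1} \<times> N k)) V) (subtopology (top_of_set M) (N n)) H"
          using k p V(2) by (intro exI[of _ ?P] exI[of _ "max k n"]) auto
      qed
    qed
  qed (simp_all add: H_def)
  ultimately show ?thesis
    unfolding homotopy_equivalence_map_def using id_cont g_cont by blast
qed

section \<open>Schauder bases: coordinates and basis projections\<close>

text \<open>The coordinates are first defined for all vectors without reference to continuity;
  \<open>basis_coord\<close> and \<open>basis_proj\<close> are bounded operators only because of the uniform bound on partial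
  sums proved below.\<close>

definition coord :: "(nat \<Rightarrow> 'e::real_normed_vector) \<Rightarrow> 'e \<Rightarrow> nat \<Rightarrow> real" where
  "coord e x = (THE a. (\<lambda>i. a i *\<^sub>R e i) sums x)"

definition basis_coord :: "(nat \<Rightarrow> 'e::real_normed_vector) \<Rightarrow> nat \<Rightarrow> 'e \<Rightarrow>\<^sub>L real" where
  "basis_coord e i = Blinfun (\<lambda>x. coord e x i)"

definition basis_proj :: "(nat \<Rightarrow> 'e::real_normed_vector) \<Rightarrow> nat \<Rightarrow> 'e \<Rightarrow>\<^sub>L 'e" where
  "basis_proj e n = Blinfun (\<lambda>x. \<Sum>i<n. coord e x i *\<^sub>R e i)"

lemma coord_sums:
  assumes "schauder_basis e"
  shows "(\<lambda>i. coord e x i *\<^sub>R e i) sums x"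
  using assms theI'[of "\<lambda>a. (\<lambda>i. a i *\<^sub>R e i) sums x"]
  unfolding schauder_basis_def coord_def by blast

lemma coord_unique:
  assumes "schauder_basis e" "(\<lambda>i. a i *\<^sub>R e i) sums x"
  shows "coord e x = a"
  using assms coord_sums[of e x] unfolding schauder_basis_def by blast

lemma coord_add:
  assumes "schauder_basis e"
  shows "coord e (x + y) i = coord e x i + coord e y i"
proof -
  have "(\<lambda>i. (coord e x i + coord e y i) *\<^sub>R e i) sums (x + y)"
    using sums_add[OF coord_sums[OF assms, of x] coord_sums[OF assms, of y]]
    by (simp add: scaleR_add_left)
  from coord_unique[OF assms this] show ?thesis
    by simp
qed

lemma coord_scaleR:
  assumes "schauder_basis e"
  shows "coord e (r *\<^sub>R x) i = r * coord e x i"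
proof -
  have "(\<lambda>i. (r * coord e x i) *\<^sub>R e i) sums (r *\<^sub>R x)"
    using sums_scaleR_right[OF coord_sums[OF assms, of x], of r] by simp
  from coord_unique[OF assms this] show ?thesis
    by simp
qed

lemma coord_basis_vector:
  assumes "schauder_basis e"
  shows "coord e (e j) i = (if i = j then 1 else 0)"
proof -
  have "(\<lambda>i. (if i = j then 1 else 0) *\<^sub>R e i) sums e j"
    using sums_single[of j e] by (simp add: if_distrib[of "\<lambda>c. c *\<^sub>R _"] cong: if_cong)
  from coord_unique[OF assms this] show ?thesis
    by simp
qed

lemma basis_vector_nonzero:
  assumes "schauder_basis e"
  shows "e i \<noteq> 0"
  using coord_basis_vector[OF assms, of i i] coord_scaleR[OF assms, of 0 "e i" i] by auto

text \<open>Every vector has bounded partial sums, so by the Baire category theorem the vectors with partial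
  sums bounded by some fixed \<open>m\<close> are dense in a ball.  Differences of such vectors are dense in a
  ball around 0, and scaling carries this to all of the space.\<close>

lemma approximation_with_bounded_partial_sums:
  fixes e :: "nat \<Rightarrow> 'e::banach"
  assumes basis: "schauder_basis e"
  defines "S \<equiv> \<lambda>n x. \<Sum>i<n. coord e x i *\<^sub>R e i"
  shows "\<exists>K\<ge>0. \<forall>y. \<exists>x. (\<forall>n. norm (S n x) \<le> K * norm y) \<and> norm (y - x) \<le> norm y / 2"
proof -
  have S_lim: "(\<lambda>n. S n x) \<longlonglongrightarrow> x" for x
    using coord_sums[OF basis, of x] by (simp add: sums_def S_def)
  have S_scale: "S n (r *\<^sub>R x) = r *\<^sub>R S n x" for n r x
    by (simp add: S_def coord_scaleR[OF basis] scaleR_sum_right)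
  have S_add: "S n (x + y) = S n x + S n y" for n x y
    by (simp add: S_def coord_add[OF basis] scaleR_add_left sum.distrib)
  have S_diff: "S n (x - y) = S n x - S n y" for n x y
    using S_add[of n x "- 1 *\<^sub>R y"] S_scale[of n "- 1" y] by simp
  define F where "F m = {x. \<forall>n. norm (S n x) \<le> real m}" for m :: nat
  have cover: "(\<Union>m. F m) = UNIV"
  proof (intro set_eqI iffI UNIV_I)
    fix x
    have "Bseq (\<lambda>n. S n x)"
      by (rule convergent_imp_Bseq[OF convergentI[OF S_lim]])
    then obtain c where "\<And>n. norm (S n x) \<le> c"
      unfolding Bseq_def by auto
    moreover obtain m where "c \<le> real m"
      using real_arch_simple by blast
    ultimately have "x \<in> F m"
      unfolding F_def by (auto intro: order_trans)
    then show "x \<in> (\<Union>m. F m)" by blast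
  qed
  have "\<exists>m. interior (closure (F m)) \<noteq> {}"
  proof (rule ccontr)
    assume no_interior: "\<not> ?thesis"
    have "euclidean interior_of \<Union> (range (\<lambda>m. closure (F m))) = {}"
    proof (rule Baire_category_alt)
      show "completely_metrizable_space (euclidean :: 'e topology) \<or>
          locally_compact_space (euclidean :: 'e topology) \<and> regular_space (euclidean :: 'e topology)"
        by (simp add: completely_metrizable_space_euclidean)
      fix T assume "T \<in> range (\<lambda>m. closure (F m))"
      then show "closedin euclidean T \<and> euclidean interior_of T = {}"
        using no_interior by auto
    qed simp
    moreover have "\<Union> (range (\<lambda>m. closure (F m))) = UNIV"
    proof -
      have "(\<Union>m. F m) \<subseteq> (\<Union>m. closure (F m))"
        by (intro UN_mono closure_subset order_refl)
      then have "UNIV \<subseteq> (\<Union>m. closure (F m))"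
        by (simp only: cover)
      then show ?thesis by blast
    qed
    ultimately show False
      by simp
  qed
  then obtain m x0 \<epsilon> where \<epsilon>: "\<epsilon> > 0" "ball x0 \<epsilon> \<subseteq> closure (F m)"
    by (metis all_not_in_conv mem_interior)
  have approx: "\<exists>x. (\<forall>n. norm (S n x) \<le> 2 * real m) \<and> norm (z - x) \<le> \<eta>"
    if z: "norm z < \<epsilon>" and \<eta>: "\<eta> > 0" for z \<eta>
  proof -
    have "x0 + z \<in> closure (F m)" "x0 \<in> closure (F m)"
      using \<epsilon> z by (auto simp: dist_norm intro!: subsetD[OF \<epsilon>(2)])
    then obtain a b where ab: "a \<in> F m" "b \<in> F m" "dist a (x0 + z) < \<eta> / 2" "dist b x0 < \<eta> / 2"
      using \<eta> by (meson closure_approachable half_gt_zero)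
    have "norm (S n (a - b)) \<le> 2 * real m" for n
      using norm_triangle_ineq4[of "S n a" "S n b"] ab(1,2)
      unfolding F_def S_diff by (smt (verit) mem_Collect_eq)
    moreover have "norm (z - (a - b)) \<le> norm (a - (x0 + z)) + norm (b - x0)"
      using norm_triangle_ineq4[of "b - x0" "a - (x0 + z)"] by (simp add: algebra_simps)
    ultimately show ?thesis
      using ab(3,4) by (intro exI[of _ "a - b"]) (auto simp: dist_norm)
  qed
  show ?thesis
  proof (intro exI[of _ "4 * real m / \<epsilon>"] conjI allI)
    show "0 \<le> 4 * real m / \<epsilon>"
      using \<epsilon> by simp
    fix y
    show "\<exists>x. (\<forall>n. norm (S n x) \<le> 4 * real m / \<epsilon> * norm y) \<and> norm (y - x) \<le> norm y / 2"
    proof (cases "y = 0")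
      case True
      then show ?thesis
        using S_scale[of _ 0] by (intro exI[of _ 0]) simp
    next
      case False
      \<comment> \<open>Scaling by \<open>t\<close> moves \<open>y\<close> to norm \<open>\<epsilon> / 2\<close>, inside the ball of radius \<open>\<epsilon>\<close> where \<open>approx\<close> applies.\<close>
      define t where "t = \<epsilon> / (2 * norm y)"
      have t: "t > 0" "t * norm y = \<epsilon> / 2"
        using \<epsilon> False by (simp_all add: t_def)
      obtain x where x: "\<And>n. norm (S n x) \<le> 2 * real m" "norm (t *\<^sub>R y - x) \<le> \<epsilon> / 4"
        using approx[of "t *\<^sub>R y" "\<epsilon> / 4"] t \<epsilon> by auto
      have "norm (S n ((1 / t) *\<^sub>R x)) \<le> 4 * real m / \<epsilon> * norm y" for n
      proof -
        have "norm (S n ((1 / t) *\<^sub>R x)) = norm (S n x) / t"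
          using t by (simp add: S_scale)
        also have "\<dots> \<le> 2 * real m / t"
          using x(1) t by (intro divide_right_mono) auto
        finally show ?thesis
          using \<epsilon> False by (simp add: t_def field_simps)
      qed
      moreover have "norm (y - (1 / t) *\<^sub>R x) \<le> norm y / 2"
      proof -
        have "y - (1 / t) *\<^sub>R x = (1 / t) *\<^sub>R (t *\<^sub>R y - x)"
          using t by (simp add: algebra_simps)
        then have "norm (y - (1 / t) *\<^sub>R x) = norm (t *\<^sub>R y - x) / t"
          using t by simp
        also have "\<dots> \<le> (\<epsilon> / 4) / t"
          using x(2) t by (intro divide_right_mono) auto
        finally show ?thesis
          using \<epsilon> False by (simp add: t_def field_simps)
      qed
      ultimately show ?thesis by blast
    qed
  qed
qed

text \<open>The approximation lemma is iterated, as in the proof of the open mapping theorem: \<open>y\<close> becomes a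
  series of vectors \<open>x k\<close> whose partial sums in the basis are bounded by a geometric sequence.
  Summing over \<open>k\<close> gives an expansion of \<open>y\<close> in the basis with bounded partial sums, and by
  uniqueness this is the expansion of \<open>y\<close>.\<close>

lemma partial_sums_uniformly_bounded:
  fixes e :: "nat \<Rightarrow> 'e::banach"
  assumes basis: "schauder_basis e"
  shows "\<exists>C. \<forall>n x. norm (\<Sum>i<n. coord e x i *\<^sub>R e i) \<le> C * norm x"
proof -
  define S where "S = (\<lambda>n x. \<Sum>i<n. coord e x i *\<^sub>R e i)"
  have S_lim: "(\<lambda>n. S n x) \<longlonglongrightarrow> x" for x
    using coord_sums[OF basis, of x] by (simp add: sums_def S_def)
  obtain K h where K: "K \<ge> 0" and h: "\<And>y n. norm (S n (h y)) \<le> K * norm y"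
    "\<And>y. norm (y - h y) \<le> norm y / 2"
    using approximation_with_bounded_partial_sums[OF basis] unfolding S_def by metis
  have "norm (S n y) \<le> 2 * K * norm y" for n y
  proof -
    \<comment> \<open>The remainder after \<open>k\<close> approximation steps.\<close>
    define \<rho> where "\<rho> = rec_nat y (\<lambda>_ r. r - h r)"
    have \<rho>_0: "\<rho> 0 = y" and \<rho>_Suc: "\<rho> (Suc k) = \<rho> k - h (\<rho> k)" for k
      by (simp_all add: \<rho>_def)
    have \<rho>_le: "norm (\<rho> k) \<le> norm y * (1 / 2) ^ k" for k
    proof (induction k)
      case (Suc k)
      then show ?case
        using h(2)[of "\<rho> k"] by (simp add: \<rho>_Suc)
    qed (simp add: \<rho>_0)
    define x where "x k = h (\<rho> k)" for k
    define c where "c k = K * norm y * (1 / 2) ^ k" for k :: nat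
    have c_sums: "c sums (2 * K * norm y)"
      using sums_mult[OF geometric_sums[of "1 / 2 :: real"], of "K * norm y"] by (simp add: c_def[abs_def] mult_ac)
    have Sx: "norm (S n (x k)) \<le> c k" for n k
    proof -
      have "norm (S n (x k)) \<le> K * norm (\<rho> k)"
        using h(1) by (simp add: x_def)
      also have "\<dots> \<le> K * (norm y * (1 / 2) ^ k)"
        using \<rho>_le K by (intro mult_left_mono)
      finally show ?thesis by (simp add: c_def)
    qed
    have x_le: "norm (x k) \<le> c k" for k
      using Lim_bounded[OF tendsto_norm[OF S_lim[of "x k"]], of 0 "c k"] Sx by blast
    have "(\<Sum>k<N. x k) = y - \<rho> N" for N
      by (induction N) (simp_all add: \<rho>_0 \<rho>_Suc x_def)
    moreover have "\<rho> \<longlonglongrightarrow> 0"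
    proof (rule Lim_null_comparison)
      show "\<forall>\<^sub>F k in sequentially. norm (\<rho> k) \<le> norm y * (1 / 2) ^ k"
        using \<rho>_le by simp
      show "(\<lambda>k. norm y * (1 / 2) ^ k) \<longlonglongrightarrow> 0"
        by (intro tendsto_mult_right_zero LIMSEQ_power_zero) simp
    qed
    ultimately have x_sums: "x sums y"
      using tendsto_diff[OF tendsto_const[of y], of \<rho> 0 sequentially] by (simp add: sums_def)
    have S_summable: "summable (\<lambda>k. S n (x k))" for n
      by (rule summable_comparison_test'[OF sums_summable[OF c_sums]]) (use Sx in auto)
    define s where "s n = (\<Sum>k. S n (x k))" for n
    \<comment> \<open>Dominated convergence for the series over \<open>k\<close> allows the limit in \<open>n\<close> to be taken termwise.\<close>
    have s_lim: "s \<longlonglongrightarrow> y"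
    proof -
      let ?a = "\<lambda>k n. norm (x k - S n (x k))"
      have a_le: "?a k n \<le> 2 * c k" for k n
        using norm_triangle_ineq4[of "x k" "S n (x k)"] x_le[of k] Sx[of n k] by linarith
      have c2: "summable (\<lambda>k. 2 * c k)"
        by (rule summable_mult[OF sums_summable[OF c_sums]])
      have "(\<lambda>n. \<Sum>k. ?a k n) \<longlonglongrightarrow> (\<Sum>k::nat. 0)"
      proof (rule conjunct2[OF conjunct2[OF tannerys_theorem[of ?a, OF _ _ c2]]])
        show "?a k \<longlonglongrightarrow> 0" for k
          using tendsto_norm[OF tendsto_diff[OF tendsto_const[of "x k"] S_lim[of "x k"]]] by simp
        show "\<forall>\<^sub>F (k, n) in at_top \<times>\<^sub>F sequentially. norm (?a k n) \<le> 2 * c k"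
          by (rule always_eventually) (use a_le in auto)
      qed simp
      moreover have "norm (y - s n) \<le> (\<Sum>k. ?a k n)" for n
      proof -
        have "summable (\<lambda>k. ?a k n)"
          by (rule summable_comparison_test'[OF c2]) (use a_le in auto)
        moreover have "(\<lambda>k. x k - S n (x k)) sums (y - s n)"
          unfolding s_def by (intro sums_diff x_sums summable_sums S_summable)
        ultimately show ?thesis
          using summable_norm sums_unique by metis
      qed
      ultimately have "(\<lambda>n. y - s n) \<longlonglongrightarrow> 0"
        by (intro Lim_null_comparison[where f = "\<lambda>n. y - s n"]) auto
      then show ?thesis
        using tendsto_diff[OF tendsto_const[of y], of "\<lambda>n. y - s n" 0 sequentially] by simp
    qed
    define b where "b i = (\<Sum>k. coord e (x k) i)" for i
    have s_Suc: "s (Suc n) = s n + b n *\<^sub>R e n" for n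
    proof -
      have diff: "S (Suc n) (x k) - S n (x k) = coord e (x k) n *\<^sub>R e n" for k
        by (simp add: S_def)
      have coord_le: "norm (coord e (x k) n) \<le> 2 * c k / norm (e n)" for k
        using norm_triangle_ineq4[of "S (Suc n) (x k)" "S n (x k)"] Sx[of n k] Sx[of "Suc n" k]
          basis_vector_nonzero[OF basis, of n] unfolding diff
        by (simp add: field_simps)
      have "summable (\<lambda>k. 2 * c k / norm (e n))"
        by (rule summable_divide[OF summable_mult[OF sums_summable[OF c_sums]]])
      then have "summable (\<lambda>k. coord e (x k) n)"
        by (rule summable_comparison_test'[where N = 0]) (rule coord_le)
      then have "(\<lambda>k. coord e (x k) n *\<^sub>R e n) sums (b n *\<^sub>R e n)"
        unfolding b_def by (rule sums_scaleR_left[OF summable_sums])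
      moreover have "(\<lambda>k. coord e (x k) n *\<^sub>R e n) sums (s (Suc n) - s n)"
        unfolding diff[symmetric] s_def by (rule sums_diff[OF summable_sums summable_sums, OF S_summable S_summable])
      ultimately show ?thesis
        using sums_unique2 by fastforce
    qed
    have s_eq: "s n = (\<Sum>i<n. b i *\<^sub>R e i)" for n
    proof (induction n)
      case 0
      show ?case by (simp add: s_def S_def)
    qed (simp add: s_Suc)
    have "(\<lambda>i. b i *\<^sub>R e i) sums y"
      using s_lim unfolding sums_def s_eq[symmetric] by simp
    then have "coord e y = b"
      by (rule coord_unique[OF basis])
    then have "norm (S n y) = norm (s n)"
      by (simp add: S_def s_eq)
    also have "\<dots> \<le> 2 * K * norm y"
      unfolding s_def sums_unique[OF c_sums]
      by (rule norm_suminf_le) (use Sx c_sums sums_summable in auto)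
    finally show ?thesis .
  qed
  then show ?thesis
    unfolding S_def by blast
qed

context
  fixes e :: "nat \<Rightarrow> 'e::banach"
  assumes basis: "schauder_basis e"
begin

lemma basis_proj_eq_sum: "basis_proj e n x = (\<Sum>i<n. coord e x i *\<^sub>R e i)"
proof -
  obtain C where C: "\<And>n x. norm (\<Sum>i<n. coord e x i *\<^sub>R e i) \<le> C * norm x"
    using partial_sums_uniformly_bounded[OF basis] by blast
  have "bounded_linear (\<lambda>x. \<Sum>i<n. coord e x i *\<^sub>R e i)"
    by (rule bounded_linear_intro[of _ C])
      (use C in \<open>simp_all add: coord_add[OF basis] coord_scaleR[OF basis] scaleR_add_left sum.distrib
        scaleR_sum_right mult.commute\<close>)
  then show ?thesis
    by (simp add: basis_proj_def bounded_linear_Blinfun_apply)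
qed

lemma basis_coord_apply: "basis_coord e i x = coord e x i"
proof -
  have coord_le: "norm (coord e x i) \<le> norm x * (norm (basis_proj e (Suc i) - basis_proj e i) / norm (e i))" for x
  proof -
    have "norm (coord e x i *\<^sub>R e i) = norm ((basis_proj e (Suc i) - basis_proj e i) x)"
      by (simp add: basis_proj_eq_sum blinfun.diff_left)
    also have "\<dots> \<le> norm (basis_proj e (Suc i) - basis_proj e i) * norm x"
      by (rule norm_blinfun)
    finally show ?thesis
      using basis_vector_nonzero[OF basis, of i] by (simp add: field_simps)
  qed
  have "bounded_linear (\<lambda>x. coord e x i)"
    by (rule bounded_linear_intro[OF _ _ coord_le]) (simp_all add: coord_add[OF basis] coord_scaleR[OF basis])
  then show ?thesis
    by (simp add: basis_coord_def bounded_linear_Blinfun_apply)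
qed

lemma basis_proj_apply: "basis_proj e n x = (\<Sum>i<n. basis_coord e i x *\<^sub>R e i)"
  by (simp add: basis_coord_apply basis_proj_eq_sum)

lemma basis_coord_basis_vector: "basis_coord e i (e j) = (if i = j then 1 else 0)"
  by (simp add: basis_coord_apply coord_basis_vector[OF basis])

lemma basis_proj_tendsto: "(\<lambda>n. basis_proj e n x) \<longlonglongrightarrow> x"
  using coord_sums[OF basis, of x] by (simp add: sums_def basis_proj_eq_sum)

lemma basis_proj_bounded: "\<exists>C. \<forall>n. norm (basis_proj e n) \<le> C"
proof -
  obtain C where C: "\<And>n x. norm (basis_proj e n x) \<le> C * norm x"
    using partial_sums_uniformly_bounded[OF basis] by (auto simp: basis_proj_eq_sum)
  have "norm (basis_proj e n) \<le> max C 0" for n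
  proof (rule norm_blinfun_bound)
    show "norm (basis_proj e n x) \<le> max C 0 * norm x" for x
      by (rule order_trans[OF C]) (simp add: mult_right_mono)
  qed simp
  then show ?thesis by blast
qed

lemma basis_proj_basis_vector: "basis_proj e n (e j) = (if j < n then e j else 0)"
  by (simp add: basis_proj_apply basis_coord_basis_vector if_distrib[of "\<lambda>c. c *\<^sub>R _"] cong: if_cong)

lemma basis_proj_in_head: "basis_proj e n x \<in> head_space e n"
  unfolding basis_proj_apply head_space_def
  by (intro span_sum span_scale span_base) auto

lemma basis_proj_head:
  assumes "x \<in> head_space e n"
  shows "basis_proj e n x = x"
  using assms unfolding head_space_def
proof (induction rule: span_induct_alt)
  case (step c x y)
  then show ?case
    by (auto simp: blinfun.add_right blinfun.scaleR_right basis_proj_basis_vector)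
qed (simp add: blinfun.zero_right)

lemma basis_proj_tail:
  assumes "x \<in> tail_space e n"
  shows "basis_proj e n x = 0"
proof -
  have "closed {x. basis_proj e n x = 0}"
    by (intro closed_Collect_eq continuous_intros)
  moreover have "basis_proj e n x = 0" if "x \<in> span (e ` {n..})" for x
    using that
  proof (induction rule: span_induct_alt)
    case (step c x y)
    then show ?case
      by (auto simp: blinfun.add_right blinfun.scaleR_right basis_proj_basis_vector)
  qed (simp add: blinfun.zero_right)
  ultimately have "closure (span (e ` {n..})) \<subseteq> {x. basis_proj e n x = 0}"
    by (intro closure_minimal) auto
  then show ?thesis
    using assms by (auto simp: tail_space_def)
qed

lemma diff_basis_proj_in_tail: "x - basis_proj e n x \<in> tail_space e n"
  unfolding tail_space_def closure_sequential
proof (intro exI conjI allI)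
  show "(\<lambda>k. basis_proj e (k + n) x - basis_proj e n x) \<longlonglongrightarrow> x - basis_proj e n x"
    by (intro tendsto_diff tendsto_const LIMSEQ_ignore_initial_segment basis_proj_tendsto)
  fix k
  have "basis_proj e (k + n) x - basis_proj e n x = (\<Sum>i\<in>{n..<k + n}. basis_coord e i x *\<^sub>R e i)"
    unfolding basis_proj_apply by (simp add: sum_diff_nat_ivl atLeast0LessThan[symmetric])
  also have "\<dots> \<in> span (e ` {n..})"
    by (intro span_sum span_scale span_base) auto
  finally show "basis_proj e (k + n) x - basis_proj e n x \<in> span (e ` {n..})" .
qed

lemma head_space_mono: "m \<le> n \<Longrightarrow> head_space e m \<subseteq> head_space e n"
  unfolding head_space_def by (intro span_mono image_mono) auto

lemma tail_space_antimono: "m \<le> n \<Longrightarrow> tail_space e n \<subseteq> tail_space e m"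
  unfolding tail_space_def by (intro closure_mono span_mono image_mono) auto

lemma basis_proj_absorb:
  assumes "m \<le> n"
  shows "basis_proj e n o\<^sub>L basis_proj e m = basis_proj e m"
    and "basis_proj e m o\<^sub>L basis_proj e n = basis_proj e m"
proof -
  show "basis_proj e n o\<^sub>L basis_proj e m = basis_proj e m"
    by (intro blinfun_eqI)
      (simp add: basis_proj_head[OF subsetD[OF head_space_mono[OF assms] basis_proj_in_head]])
  have "basis_proj e m (x - basis_proj e n x) = 0" for x
    using basis_proj_tail diff_basis_proj_in_tail tail_space_antimono[OF assms] by blast
  then show "basis_proj e m o\<^sub>L basis_proj e n = basis_proj e m"
    by (intro blinfun_eqI) (auto simp: blinfun.diff_right)
qed

end

section \<open>Compact operators and shrinking bases\<close>

lemma op_of_Compact_op: "compact_operator T \<Longrightarrow> op_of (Compact_op T) = T"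
  by (simp add: Compact_op_inverse)

lemma op_of_sum: "op_of (\<Sum>i\<in>I. f i) = (\<Sum>i\<in>I. op_of (f i))"
  by (induction I rule: infinite_finite_induct) auto

lemma bounded_linear_op_of: "bounded_linear op_of"
  by (rule bounded_linear_intro[of _ 1]) (auto simp: norm_compact_op_def)

lemma compact_operator_rank_one:
  fixes f :: "'a::real_normed_vector \<Rightarrow>\<^sub>L real" and v :: "'b::real_normed_vector"
  shows "compact_operator (blinfun_scaleR_left v o\<^sub>L f)"
proof -
  let ?K = "(\<lambda>t. t *\<^sub>R v) ` {- norm f..norm f}"
  have K: "compact ?K"
    by (intro compact_continuous_image continuous_intros) auto
  have "(blinfun_scaleR_left v o\<^sub>L f) ` cball 0 1 \<subseteq> ?K"
  proof (rule image_subsetI)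
    fix x :: 'a assume "x \<in> cball 0 1"
    then have "norm f * norm x \<le> norm f"
      by (simp add: mult_left_le)
    then have "\<bar>f x\<bar> \<le> norm f"
      using norm_blinfun[of f x] by simp
    then show "(blinfun_scaleR_left v o\<^sub>L f) x \<in> ?K"
      by (intro image_eqI[of _ _ "f x"]) auto
  qed
  then have "closure ((blinfun_scaleR_left v o\<^sub>L f) ` cball 0 1) \<subseteq> ?K"
    using K by (simp add: closure_minimal compact_imp_closed)
  then show ?thesis
    unfolding compact_operator_def using K
    by (metis closed_closure compact_Int_closed inf.absorb_iff2)
qed

lemma compact_operator_sum:
  assumes "\<And>i. i \<in> I \<Longrightarrow> compact_operator (T i)"
  shows "compact_operator (\<Sum>i\<in>I. T i)"
  using assms by (induction I rule: infinite_finite_induct) (auto simp: compact_operator_0 compact_operator_add)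

lemma norm_add_diff_le: "norm (a + b - c) \<le> norm a + norm b + norm c"
  for a b c :: "'a::real_normed_vector"
  using norm_triangle_ineq4[of "a + b" c] norm_triangle_ineq[of a b] by linarith

text \<open>Pointwise convergence on a finite net suffices, because the \<open>R n\<close> share a Lipschitz constant.\<close>

lemma equicontinuous_tendsto_uniformly_on_compact:
  fixes R :: "nat \<Rightarrow> 'a::real_normed_vector \<Rightarrow>\<^sub>L 'a"
  assumes bound: "\<And>n. norm (R n) \<le> C" and lim: "\<And>x. (\<lambda>n. R n x) \<longlonglongrightarrow> x"
    and S: "compact S" and \<epsilon>: "\<epsilon> > 0"
  shows "\<exists>N. \<forall>n\<ge>N. \<forall>x\<in>S. norm (R n x - x) < \<epsilon>"
proof -
  have C: "C \<ge> 0"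
    using bound[of 0] norm_ge_zero order_trans by blast
  \<comment> \<open>Moving from \<open>x\<close> to a point of the \<open>\<delta>\<close>-net changes \<open>R n x - x\<close> by at most \<open>(C + 1) * \<delta> = \<epsilon> / 2\<close>.\<close>
  define \<delta> where "\<delta> = \<epsilon> / (2 * (C + 1))"
  have \<delta>: "\<delta> > 0"
    using C \<epsilon> by (simp add: \<delta>_def)
  obtain F where F: "finite F" "S \<subseteq> (\<Union>z\<in>F. ball z \<delta>)"
    using S \<delta> unfolding compact_eq_totally_bounded by blast
  have "\<forall>\<^sub>F n in sequentially. \<forall>z\<in>F. norm (R n z - z) < \<epsilon> / 2"
  proof (intro eventually_ball_finite[OF F(1)] ballI)
    fix z
    show "\<forall>\<^sub>F n in sequentially. norm (R n z - z) < \<epsilon> / 2"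
      using tendstoD[OF lim[of z], of "\<epsilon> / 2"] \<epsilon> by (simp add: dist_norm)
  qed
  then obtain N where N: "\<And>n z. n \<ge> N \<Longrightarrow> z \<in> F \<Longrightarrow> norm (R n z - z) < \<epsilon> / 2"
    unfolding eventually_sequentially by blast
  have "norm (R n x - x) < \<epsilon>" if n: "n \<ge> N" and x: "x \<in> S" for n x
  proof -
    obtain z where z: "z \<in> F" "norm (x - z) < \<delta>"
      using F(2) x by (auto simp: dist_norm norm_minus_commute)
    have "norm (R n (x - z)) \<le> C * norm (x - z)"
      using norm_blinfun[of "R n" "x - z"] mult_right_mono[OF bound[of n], of "norm (x - z)"] by simp
    moreover have "C * norm (x - z) + norm (x - z) \<le> (C + 1) * \<delta>"
      using z(2) C mult_left_mono[of "norm (x - z)" \<delta> "C + 1"] by (simp add: algebra_simps)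
    moreover have "(C + 1) * \<delta> = \<epsilon> / 2"
      using C by (simp add: \<delta>_def divide_simps)
    moreover have "R n x - x = R n (x - z) + (R n z - z) - (x - z)"
      by (simp add: blinfun.diff_right)
    then have "norm (R n x - x) \<le> norm (R n (x - z)) + norm (R n z - z) + norm (x - z)"
      by (simp only: norm_add_diff_le)
    ultimately show ?thesis
      using N[OF n z(1)] by linarith
  qed
  then show ?thesis by blast
qed

lemma compose_compact_tendsto:
  fixes R :: "nat \<Rightarrow> 'b::real_normed_vector \<Rightarrow>\<^sub>L 'b" and T :: "'a::real_normed_vector \<Rightarrow>\<^sub>L 'b"
  assumes bound: "\<And>n. norm (R n) \<le> C" and lim: "\<And>x. (\<lambda>n. R n x) \<longlonglongrightarrow> x"
    and T: "compact_operator T"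
  shows "(\<lambda>n. R n o\<^sub>L T) \<longlonglongrightarrow> T"
proof (rule LIMSEQ_I)
  fix \<epsilon> :: real assume \<epsilon>: "\<epsilon> > 0"
  obtain N where N: "\<And>n x. n \<ge> N \<Longrightarrow> x \<in> closure (T ` cball 0 1) \<Longrightarrow> norm (R n x - x) < \<epsilon> / 2"
    using equicontinuous_tendsto_uniformly_on_compact[OF bound lim, of "closure (T ` cball 0 1)" "\<epsilon> / 2"]
      T \<epsilon> unfolding compact_operator_def by auto
  have "norm ((R n o\<^sub>L T) - T) \<le> \<epsilon> / 2" if n: "n \<ge> N" for n
  proof (rule norm_blinfun_bound)
    fix x
    show "norm (((R n o\<^sub>L T) - T) x) \<le> \<epsilon> / 2 * norm x"
    proof (cases "x = 0")
      case False
      have "sgn x \<in> cball 0 1"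
        by (simp add: norm_sgn)
      then have "T (sgn x) \<in> closure (T ` cball 0 1)"
        by (intro subsetD[OF closure_subset] imageI)
      then have le: "norm (((R n o\<^sub>L T) - T) (sgn x)) \<le> \<epsilon> / 2"
        using N[OF n] by (simp add: blinfun.diff_left less_imp_le)
      have eq: "((R n o\<^sub>L T) - T) x = norm x *\<^sub>R ((R n o\<^sub>L T) - T) (sgn x)"
        using False by (simp add: sgn_div_norm flip: blinfun.scaleR_right)
      show ?thesis
        unfolding eq norm_scaleR using mult_left_mono[OF le, of "norm x"] by (simp add: mult.commute)
    qed (simp add: blinfun.zero_right)
  qed (use \<epsilon> in simp)
  then show "\<exists>N. \<forall>n\<ge>N. norm ((R n o\<^sub>L T) - T) < \<epsilon>"
    using \<epsilon> field_sum_of_halves[of \<epsilon>] by (metis half_gt_zero le_less_trans less_add_same_cancel2)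
qed

lemma norm_le_restricted_norm:
  fixes f :: "'a::real_normed_vector \<Rightarrow>\<^sub>L real"
  assumes "subspace V" "v \<in> V"
  shows "\<bar>f v\<bar> \<le> restricted_norm f V * norm v"
proof (cases "v = 0")
  case False
  have "\<bar>f (sgn v)\<bar> \<le> restricted_norm f V"
    unfolding restricted_norm_def
  proof (rule cSUP_upper)
    show "sgn v \<in> {v \<in> V. norm v \<le> 1}"
      using assms False by (simp add: sgn_div_norm subspace_scale)
    show "bdd_above ((\<lambda>v. \<bar>f v\<bar>) ` {v \<in> V. norm v \<le> 1})"
    proof (rule bdd_aboveI2)
      fix x assume "x \<in> {v \<in> V. norm v \<le> 1}"
      then show "\<bar>f x\<bar> \<le> norm f"
        using norm_blinfun[of f x] mult_left_le[of "norm x" "norm f"] by auto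
    qed
  qed
  moreover have "f v = norm v * f (sgn v)"
    using False by (simp add: sgn_div_norm blinfun.scaleR_right)
  ultimately show ?thesis
    by (simp add: abs_mult mult.commute[of _ "norm v"] mult_left_mono)
qed (simp add: blinfun.zero_right)

lemma blinfun_compose_assoc: "f o\<^sub>L g o\<^sub>L h = f o\<^sub>L (g o\<^sub>L h)"
  by (rule blinfun_eqI) simp

lemma tail_space_eq_kernel:
  fixes e :: "nat \<Rightarrow> 'e::banach"
  assumes "schauder_basis e"
  shows "tail_space e n = {x. basis_proj e n x = 0}"
  using basis_proj_tail[OF assms] diff_basis_proj_in_tail[OF assms, of _ n]
  by (metis (mono_tags, lifting) diff_zero mem_Collect_eq subsetI subset_antisym)

lemma subspace_tail_space:
  fixes e :: "nat \<Rightarrow> 'e::banach"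
  assumes "schauder_basis e"
  shows "subspace (tail_space e n)"
  unfolding tail_space_eq_kernel[OF assms] by (simp add: subspace_def blinfun.bilinear_simps)

text \<open>The functional \<open>f - f P\<^sub>n\<close> is \<open>f\<close> evaluated on \<open>x - P\<^sub>n x\<close>, which lies in the tail space and has norm at
  most \<open>1 + C\<close> times that of \<open>x\<close>, where \<open>C\<close> bounds the norms of all \<open>P\<^sub>n\<close>; so the
  shrinking condition bounds the norm of this functional by a null sequence.\<close>

lemma functional_compose_basis_proj_tendsto:
  fixes e :: "nat \<Rightarrow> 'e::banach" and f :: "'e \<Rightarrow>\<^sub>L real"
  assumes "shrinking_basis e"
  shows "(\<lambda>n. f o\<^sub>L basis_proj e n) \<longlonglongrightarrow> f"
proof -
  have basis: "schauder_basis e" and r0: "(\<lambda>n. restricted_norm f (tail_space e n)) \<longlonglongrightarrow> 0"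
    using assms by (auto simp: shrinking_basis_def)
  obtain C where C: "\<And>n. norm (basis_proj e n) \<le> C"
    using basis_proj_bounded[OF basis] by blast
  let ?r = "\<lambda>n. restricted_norm f (tail_space e n)"
  have r_nonneg: "?r n \<ge> 0" for n
    using norm_le_restricted_norm[OF subspace_tail_space[OF basis], of "e n" n f]
      basis_vector_nonzero[OF basis, of n]
      diff_basis_proj_in_tail[OF basis, of "e n" n] basis_proj_basis_vector[OF basis, of n n]
    using order_trans[OF abs_ge_zero, of "f (e n)" "?r n * norm (e n)"] by (simp add: zero_le_mult_iff)
  have le: "norm ((f o\<^sub>L basis_proj e n) - f) \<le> ?r n * (1 + C)" for n
  proof (rule norm_blinfun_bound)
    have "0 \<le> C"
      using C[of 0] norm_ge_zero order_trans by blast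
    then show "0 \<le> ?r n * (1 + C)"
      using r_nonneg by simp
    fix x
    have "norm (x - basis_proj e n x) \<le> norm x + C * norm x"
      using norm_triangle_ineq4[of x "basis_proj e n x"] norm_blinfun[of "basis_proj e n" x]
        mult_right_mono[OF C[of n], of "norm x"] by simp
    then have "?r n * norm (x - basis_proj e n x) \<le> ?r n * (norm x + C * norm x)"
      using r_nonneg by (rule mult_left_mono)
    moreover have "\<bar>f (x - basis_proj e n x)\<bar> \<le> ?r n * norm (x - basis_proj e n x)"
      by (rule norm_le_restricted_norm[OF subspace_tail_space[OF basis] diff_basis_proj_in_tail[OF basis]])
    moreover have "norm (((f o\<^sub>L basis_proj e n) - f) x) = \<bar>f (x - basis_proj e n x)\<bar>"
      by (simp add: blinfun.diff_left blinfun.diff_right abs_minus_commute)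
    ultimately show "norm (((f o\<^sub>L basis_proj e n) - f) x) \<le> ?r n * (1 + C) * norm x"
      by (simp add: algebra_simps)
  qed
  have "(\<lambda>n. (f o\<^sub>L basis_proj e n) - f) \<longlonglongrightarrow> 0"
  proof (rule Lim_null_comparison)
    show "(\<lambda>n. ?r n * (1 + C)) \<longlonglongrightarrow> 0"
      using r0 by (rule tendsto_mult_left_zero)
  qed (use le in simp)
  then show ?thesis
    by (rule LIM_zero_cancel)
qed

text \<open>Left multiplication by \<open>P\<^sub>n\<close> converges because \<open>T\<close> is compact.  For right multiplication, \<open>T\<close> is
  replaced by the nearby finite-rank operator \<open>P\<^sub>m T\<close>, a finite sum of operators \<open>x \<mapsto> f(x) e\<^sub>i\<close>, where
  the shrinking condition applies to each \<open>f\<close>.\<close>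

lemma compact_compose_basis_proj_tendsto:
  fixes e :: "nat \<Rightarrow> 'e::banach" and T :: "'e \<Rightarrow>\<^sub>L 'e"
  assumes shr: "shrinking_basis e" and T: "compact_operator T"
  shows "(\<lambda>n. basis_proj e n o\<^sub>L T o\<^sub>L basis_proj e n) \<longlonglongrightarrow> T"
proof -
  have basis: "schauder_basis e"
    using shr by (auto simp: shrinking_basis_def)
  obtain C where C: "\<And>n. norm (basis_proj e n) \<le> C"
    using basis_proj_bounded[OF basis] by blast
  have C0: "0 \<le> C"
    using C[of 0] norm_ge_zero order_trans by blast
  let ?P = "basis_proj e"
  have left: "(\<lambda>n. ?P n o\<^sub>L T) \<longlonglongrightarrow> T"
    by (rule compose_compact_tendsto[OF C basis_proj_tendsto[OF basis] T])
  have finite_rank: "(\<lambda>n. ?P m o\<^sub>L T o\<^sub>L ?P n) \<longlonglongrightarrow> (?P m o\<^sub>L T)" for m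
  proof -
    have expand: "?P m o\<^sub>L S = (\<Sum>i<m. blinfun_scaleR_left (e i) o\<^sub>L (basis_coord e i o\<^sub>L S))" for S :: "'e \<Rightarrow>\<^sub>L 'e"
      by (rule blinfun_eqI) (simp add: basis_proj_apply[OF basis] blinfun.sum_left)
    have expand_P: "?P m o\<^sub>L T o\<^sub>L ?P n = (\<Sum>i<m. blinfun_scaleR_left (e i) o\<^sub>L (basis_coord e i o\<^sub>L T o\<^sub>L ?P n))" for n
      by (simp only: blinfun_compose_assoc expand[of "T o\<^sub>L ?P n"])
    have "(\<lambda>n. \<Sum>i<m. blinfun_scaleR_left (e i) o\<^sub>L (basis_coord e i o\<^sub>L T o\<^sub>L ?P n))
        \<longlonglongrightarrow> (\<Sum>i<m. blinfun_scaleR_left (e i) o\<^sub>L (basis_coord e i o\<^sub>L T))"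
      by (intro tendsto_intros functional_compose_basis_proj_tendsto shr)
    then show ?thesis
      unfolding expand_P unfolding expand[of T] .
  qed
  have right: "(\<lambda>n. T o\<^sub>L ?P n) \<longlonglongrightarrow> T"
  proof (rule LIMSEQ_I)
    fix \<epsilon> :: real assume \<epsilon>: "\<epsilon> > 0"
    \<comment> \<open>The three errors below are at most \<open>\<delta>\<close>, \<open>\<delta>\<close> and \<open>C * \<delta>\<close>.\<close>
    define \<delta> where "\<delta> = \<epsilon> / (C + 2)"
    have \<delta>: "\<delta> > 0" "C * \<delta> + \<delta> + \<delta> = \<epsilon>"
    proof -
      have "C * \<delta> + \<delta> + \<delta> = (C + 2) * \<delta>"
        by (simp add: algebra_simps)
      then show "\<delta> > 0" "C * \<delta> + \<delta> + \<delta> = \<epsilon>"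
        using \<epsilon> C0 by (simp_all add: \<delta>_def)
    qed
    obtain m where m: "norm ((?P m o\<^sub>L T) - T) < \<delta>"
      using LIMSEQ_D[OF left \<delta>(1)] order_refl by metis
    obtain N where N: "\<And>n. n \<ge> N \<Longrightarrow> norm ((?P m o\<^sub>L T o\<^sub>L ?P n) - (?P m o\<^sub>L T)) < \<delta>"
      using LIMSEQ_D[OF finite_rank[of m] \<delta>(1)] by blast
    have "norm ((T o\<^sub>L ?P n) - T) < \<epsilon>" if n: "n \<ge> N" for n
    proof -
      have "(T o\<^sub>L ?P n) - T = ((?P m o\<^sub>L T o\<^sub>L ?P n) - (?P m o\<^sub>L T)) + ((?P m o\<^sub>L T) - T) - (((?P m o\<^sub>L T) - T) o\<^sub>L ?P n)"
        by (rule blinfun_eqI) (simp add: blinfun.bilinear_simps)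
      then have "norm ((T o\<^sub>L ?P n) - T) \<le> norm ((?P m o\<^sub>L T o\<^sub>L ?P n) - (?P m o\<^sub>L T)) + norm ((?P m o\<^sub>L T) - T)
          + norm (((?P m o\<^sub>L T) - T) o\<^sub>L ?P n)"
        by (simp only: norm_add_diff_le)
      moreover have "norm (((?P m o\<^sub>L T) - T) o\<^sub>L ?P n) \<le> \<delta> * C"
        using norm_blinfun_compose[of "(?P m o\<^sub>L T) - T" "?P n"] mult_mono[OF less_imp_le[OF m] C[of n]] \<delta>
        by simp
      ultimately show ?thesis
        using N[OF n] m \<delta>(2) by (simp add: mult.commute)
    qed
    then show "\<exists>N. \<forall>n\<ge>N. norm ((T o\<^sub>L ?P n) - T) < \<epsilon>" by blast
  qed
  have "(\<lambda>n. (?P n o\<^sub>L T o\<^sub>L ?P n) - (?P n o\<^sub>L T)) \<longlonglongrightarrow> 0"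
  proof (rule Lim_null_comparison)
    show "\<forall>\<^sub>F n in sequentially. norm ((?P n o\<^sub>L T o\<^sub>L ?P n) - (?P n o\<^sub>L T)) \<le> C * norm ((T o\<^sub>L ?P n) - T)"
    proof (intro always_eventually allI)
      fix n
      have "(?P n o\<^sub>L T o\<^sub>L ?P n) - (?P n o\<^sub>L T) = ?P n o\<^sub>L ((T o\<^sub>L ?P n) - T)"
        by (rule blinfun_eqI) (simp add: blinfun.bilinear_simps)
      then show "norm ((?P n o\<^sub>L T o\<^sub>L ?P n) - (?P n o\<^sub>L T)) \<le> C * norm ((T o\<^sub>L ?P n) - T)"
        using norm_blinfun_compose[of "?P n" "(T o\<^sub>L ?P n) - T"]
          mult_right_mono[OF C[of n], of "norm ((T o\<^sub>L ?P n) - T)"] by simp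
    qed
    show "(\<lambda>n. C * norm ((T o\<^sub>L ?P n) - T)) \<longlonglongrightarrow> 0"
      by (intro tendsto_mult_right_zero tendsto_norm_zero LIM_zero right)
  qed
  from tendsto_add[OF this left] show ?thesis by simp
qed

section \<open>The general linear group is open\<close>

text \<open>Solving \<open>x - S x = y\<close> is a fixed point problem for the contraction \<open>x \<mapsto> y + S x\<close>; uniqueness of
  the fixed point makes the solution linear in \<open>y\<close>.\<close>

lemma id_minus_small_in_GL:
  fixes S :: "'e::banach \<Rightarrow>\<^sub>L 'e"
  assumes S: "norm S < 1"
  shows "id_blinfun - S \<in> GL"
proof -
  have contraction: "norm (S x - S y) \<le> norm S * norm (x - y)" for x y
    by (metis blinfun.diff_right norm_blinfun)
  have "\<exists>!x. y + S x = x" for y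
  proof (rule banach_fix_type)
    show "\<forall>x z. dist (y + S x) (y + S z) \<le> norm S * dist x z"
      using contraction by (simp add: dist_norm)
  qed (use S in auto)
  then obtain R where R: "\<And>y. y + S (R y) = R y" and unique: "\<And>x y. y + S x = x \<Longrightarrow> x = R y"
    by metis
  have "bounded_linear R"
  proof (rule bounded_linear_intro[where K = "1 / (1 - norm S)"])
    fix x y :: 'e and r :: real
    have "x + y + S (R x + R y) = (x + S (R x)) + (y + S (R y))"
      by (simp add: blinfun.add_right)
    then show "R (x + y) = R x + R y"
      using unique[of "x + y" "R x + R y"] by (simp add: R)
    have "r *\<^sub>R x + S (r *\<^sub>R R x) = r *\<^sub>R (x + S (R x))"
      by (simp add: blinfun.scaleR_right scaleR_add_right)
    then show "R (r *\<^sub>R x) = r *\<^sub>R R x"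
      using unique[of "r *\<^sub>R x" "r *\<^sub>R R x"] by (simp add: R)
    have "norm (R x) \<le> norm x + norm S * norm (R x)"
      using norm_triangle_ineq[of x "S (R x)"] norm_blinfun[of S "R x"] by (simp add: R)
    then show "norm (R x) \<le> norm x * (1 / (1 - norm S))"
      using S by (simp add: field_simps)
  qed
  then have R_apply: "Blinfun R x = R x" for x
    by (simp add: bounded_linear_Blinfun_apply)
  have "(id_blinfun - S) o\<^sub>L Blinfun R = id_blinfun"
    by (rule blinfun_eqI) (use R in \<open>simp add: R_apply blinfun.diff_left diff_eq_eq\<close>)
  moreover have "R (x - S x) = x" for x
    using unique[of "x - S x" x] by simp
  then have "Blinfun R o\<^sub>L (id_blinfun - S) = id_blinfun"
    by (intro blinfun_eqI) (simp add: R_apply blinfun.diff_left)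
  ultimately show ?thesis
    unfolding GL_def by blast
qed

lemma GL_compose:
  assumes "S \<in> GL" "T \<in> GL"
  shows "S o\<^sub>L T \<in> GL"
proof -
  obtain S' T' where "S o\<^sub>L S' = id_blinfun" "S' o\<^sub>L S = id_blinfun" "T o\<^sub>L T' = id_blinfun" "T' o\<^sub>L T = id_blinfun"
    using assms by (auto simp: GL_def)
  then have "S (S' x) = x" "S' (S x) = x" "T (T' x) = x" "T' (T x) = x" for x
    by (metis blinfun_apply_blinfun_compose blinfun_apply_id_blinfun id_apply)+
  then have "(S o\<^sub>L T) o\<^sub>L (T' o\<^sub>L S') = id_blinfun" "(T' o\<^sub>L S') o\<^sub>L (S o\<^sub>L T) = id_blinfun"
    by (auto intro!: blinfun_eqI)
  then show ?thesis
    unfolding GL_def by blast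
qed

text \<open>If \<open>R\<close> inverts \<open>T\<close>, then \<open>T' = T (I - R (T - T'))\<close>.\<close>

lemma open_GL: "open (GL :: ('e::banach \<Rightarrow>\<^sub>L 'e) set)"
  unfolding open_dist
proof
  fix T :: "'e \<Rightarrow>\<^sub>L 'e" assume T: "T \<in> GL"
  then obtain R where R: "T o\<^sub>L R = id_blinfun" "R o\<^sub>L T = id_blinfun"
    by (auto simp: GL_def)
  \<comment> \<open>Adding 1 keeps the radius meaningful when \<open>R = 0\<close>, which happens on the zero space.\<close>
  have "T' \<in> GL" if T': "dist T' T < 1 / (norm R + 1)" for T'
  proof -
    have pos: "norm R + 1 > 0"
      using norm_ge_zero[of R] by linarith
    have "norm (R o\<^sub>L (T - T')) \<le> norm R * norm (T - T')"
      by (rule norm_blinfun_compose)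
    also have "\<dots> \<le> (norm R + 1) * norm (T - T')"
      by (intro mult_right_mono) auto
    also have "\<dots> < 1"
      using T' pos by (simp add: dist_norm norm_minus_commute field_simps)
    finally have "T o\<^sub>L (id_blinfun - (R o\<^sub>L (T - T'))) \<in> GL"
      by (intro GL_compose T id_minus_small_in_GL)
    moreover have "T (R x) = x" for x
      using R(1) by (metis blinfun_apply_blinfun_compose blinfun_apply_id_blinfun id_apply)
    then have "T o\<^sub>L (id_blinfun - (R o\<^sub>L (T - T'))) = T'"
      by (intro blinfun_eqI) (simp add: blinfun.bilinear_simps)
    ultimately show ?thesis by simp
  qed
  then show "\<exists>d>0. \<forall>T'. dist T' T < d \<longrightarrow> T' \<in> GL"
    by (intro exI[of _ "1 / (norm R + 1)"]) (auto intro: add_nonneg_pos)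
qed

section \<open>Manifolds with a global chart and their linear slices\<close>

text \<open>The only smooth maps needed are affine: the chart expressions of the chart itself, straight
  lines as curves, and the trivialisation of the normal bundle.\<close>

lemma smooth_on_affine:
  fixes L :: "'a::real_normed_vector \<Rightarrow> 'b::real_normed_vector"
  assumes L: "bounded_linear L" and S: "open S" and f: "\<And>x. x \<in> S \<Longrightarrow> f x = L x + c"
  shows "smooth_on S f"
proof -
  obtain K where K: "\<And>x. norm (L x) \<le> norm x * K"
    using bounded_linear.bounded[OF L] by blast
  define D where "D k x vs = (if k = 0 then L x + c else if k = 1 then L (hd vs) else 0)"
    for k :: nat and x vs
  have "bounded_multilinear k (D k x)" for k x
  proof -
    consider "k = 0" | "k = 1" | "k > 1" by linarith
    then show ?thesis
    proof cases
      case 1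
      then show ?thesis
        by (auto simp: bounded_multilinear_def D_def intro!: exI[of _ "norm (L x + c)"])
    next
      case 2
      have "linear (\<lambda>v. L (hd (vs[i := v])))" if "length vs = 1" "i < 1" for vs i
        using that L by (cases vs) (auto simp: bounded_linear.linear)
      moreover have "norm (L (hd vs)) \<le> K * prod_list (map norm vs)" if "length vs = 1" for vs
        using that K by (cases vs) (auto simp: mult.commute)
      ultimately show ?thesis
        using 2 by (auto simp: bounded_multilinear_def D_def)
    next
      case 3
      then show ?thesis
        by (auto simp: bounded_multilinear_def D_def module_hom_zero intro!: exI[of _ 0] linearI)
    qed
  qed
  moreover have "D k y vs - D k x vs - D (Suc k) x ((y - x) # vs) = 0" for k x y vs
    using linear_diff[OF bounded_linear.linear[OF L], of y x] by (simp add: D_def)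
  moreover have "prod_list (map norm vs) \<ge> 0" for vs :: "'a list"
    by (rule prod_list_nonneg) auto
  moreover have "D 0 x [] = f x" if "x \<in> S" for x
    using f that by (simp add: D_def)
  ultimately show ?thesis
    unfolding smooth_on_def using S by (intro conjI exI[of _ D]) (auto intro!: always_eventually)
qed

lemma diffeo_id: "open W \<Longrightarrow> diffeo id W W"
  unfolding diffeo_def
  by (intro conjI bij_betw_id smooth_on_affine[of "\<lambda>x. x" _ _ 0])
    (auto simp: inv_into_f_f inj_on_def intro: inv_into_f_eq)

lemma frechet_derivative_identity_on_open:
  assumes "open W" "p \<in> W" "\<And>q. q \<in> W \<Longrightarrow> h q = q"
  shows "frechet_derivative h (at p) = (\<lambda>v. v)"
proof -
  have "(h has_derivative (\<lambda>v. v)) (at p)"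
    by (rule has_derivative_transform_within_open[OF has_derivative_ident assms(1,2)])
      (simp add: assms(3))
  then show ?thesis
    by (rule frechet_derivative_at[symmetric])
qed

lemma fredholm_operator_identity: "fredholm_operator (\<lambda>v::'a::real_normed_vector. v) 0"
proof -
  have "has_dim {0::'a} 0"
    unfolding has_dim_def by (intro exI[of _ "{}"]) (simp add: independent_empty)
  moreover have "direct_sum UNIV {0::'a} UNIV"
    by (auto simp: direct_sum_def)
  ultimately show ?thesis
    by (auto simp: fredholm_operator_def has_codim_def intro!: exI[of _ "0::nat"])
qed

text \<open>The slice is described by a bounded linear map \<open>p\<close> with fixed space the slice direction: a curve
  \<open>\<gamma>\<close> in the slice satisfies \<open>p \<circ> \<gamma> = \<gamma>\<close>, so uniqueness of derivatives gives \<open>p v = v\<close> for its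
  velocity.  Conversely every fixed vector is the velocity of a line.\<close>

lemma tangent_space_linear_slice:
  fixes \<phi> :: "'a \<Rightarrow> 'm::banach" and p :: "'m \<Rightarrow> 'm"
  assumes W: "open W" and p: "bounded_linear p"
    and slice: "\<phi> ` (N \<inter> U) = W \<inter> {v. p v = v}" and x: "x \<in> N \<inter> U"
  shows "tangent_space (U, \<phi>) N x = {v. p v = v}"
proof (intro subset_antisym subsetI)
  fix v assume "v \<in> tangent_space (U, \<phi>) N x"
  then obtain \<epsilon> \<gamma> where \<gamma>: "\<epsilon> > 0" "\<gamma> ` {-\<epsilon><..<\<epsilon>} \<subseteq> \<phi> ` (N \<inter> U)"
    "(\<gamma> has_vector_derivative v) (at (0::real))"
    by (auto simp: tangent_space_def)
  have fixed: "p (\<gamma> t) = \<gamma> t" if "t \<in> {-\<epsilon><..<\<epsilon>}" for t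
    using \<gamma>(2) that unfolding slice by blast
  have "((\<lambda>t. p (\<gamma> t)) has_vector_derivative p v) (at 0)"
    by (rule bounded_linear.has_vector_derivative[OF p \<gamma>(3)])
  then have "(\<gamma> has_vector_derivative p v) (at 0)"
    by (rule has_vector_derivative_transform_within_open[of _ _ _ "{-\<epsilon><..<\<epsilon>}"])
      (use \<gamma>(1) fixed in auto)
  then show "v \<in> {v. p v = v}"
    using \<gamma>(3) vector_derivative_unique_at by blast
next
  fix v assume v: "v \<in> {v. p v = v}"
  interpret p: bounded_linear p by (rule p)
  have \<phi>x: "\<phi> x \<in> W" "p (\<phi> x) = \<phi> x"
    using slice x by auto
  have "open ((\<lambda>t::real. \<phi> x + t *\<^sub>R v) -` W)"
    by (intro open_vimage W continuous_intros)
  then obtain \<epsilon> where \<epsilon>: "\<epsilon> > 0" "ball (0::real) \<epsilon> \<subseteq> (\<lambda>t. \<phi> x + t *\<^sub>R v) -` W"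
    using \<phi>x(1) open_contains_ball_eq[of "(\<lambda>t::real. \<phi> x + t *\<^sub>R v) -` W" 0] by auto
  have "smooth_on {-\<epsilon><..<\<epsilon>} (\<lambda>t. \<phi> x + t *\<^sub>R v)"
    by (rule smooth_on_affine[of "\<lambda>t. t *\<^sub>R v" _ _ "\<phi> x"])
      (auto intro: bounded_linear_scaleR_left)
  moreover have "(\<lambda>t. \<phi> x + t *\<^sub>R v) ` {-\<epsilon><..<\<epsilon>} \<subseteq> \<phi> ` (N \<inter> U)"
    unfolding slice using \<epsilon>(2) v \<phi>x by (auto simp: p.add p.scaleR subset_iff dist_real_def)
  moreover have "((\<lambda>t. \<phi> x + t *\<^sub>R v) has_vector_derivative v) (at 0)"
    by (auto intro!: derivative_eq_intros)
  ultimately show "v \<in> tangent_space (U, \<phi>) N x"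
    unfolding tangent_space_def using \<epsilon>(1) by (auto intro!: exI[of _ \<epsilon>] exI[of _ "\<lambda>t. \<phi> x + t *\<^sub>R v"])
qed

lemma mtopology_global_chart:
  assumes \<phi>: "homeomorphic_map X (top_of_set (\<phi> ` topspace X)) \<phi>" and W: "open (\<phi> ` topspace X)"
  shows "mtopology {(topspace X, \<phi>)} = X"
proof -
  have "V \<subseteq> topspace X \<and> open (\<phi> ` (V \<inter> topspace X)) \<longleftrightarrow> openin X V" for V
  proof (cases "V \<subseteq> topspace X")
    case True
    then show ?thesis
      using homeomorphic_map_openness[OF \<phi> True] openin_open_eq[OF W] by (auto simp: Int_absorb2 image_mono)
  qed (auto dest: openin_subset)
  then have "mtopology {(topspace X, \<phi>)} = topology (openin X)"
    by (simp add: mtopology_def mcarrier_def)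
  then show ?thesis
    by (simp add: openin_inverse)
qed

context
  fixes U :: "'a set" and \<phi> :: "'a \<Rightarrow> 'm::banach"
  assumes inj: "inj_on \<phi> U" and W: "open (\<phi> ` U)"
begin

lemma banach_manifold_global_chart:
  assumes "Hausdorff_space (mtopology {(U, \<phi>)})"
  shows "banach_manifold {(U, \<phi>)}"
proof -
  have "smooth_on (\<phi> ` U) (\<phi> \<circ> inv_into U \<phi>)"
    using W by (intro smooth_on_affine[of "\<lambda>v. v" _ _ 0]) (auto simp: f_inv_into_f)
  then show ?thesis
    using assms inj W by (simp add: banach_manifold_def)
qed

lemma chart_differential_chart:
  assumes "x \<in> U"
  shows "chart_differential (U, \<phi>) (UNIV, id) \<phi> x = (\<lambda>v. v)"
    and "chart_differential (U, \<phi>) (U, \<phi>) id x = (\<lambda>v. v)"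
  unfolding chart_differential_def
  by (rule frechet_derivative_identity_on_open[OF W]; use assms in \<open>auto simp: f_inv_into_f\<close>)+

lemma fredholm_map_chart: "fredholm_map {(U, \<phi>)} banach_space_atlas \<phi> 0"
proof -
  have "smooth_on (\<phi> ` U) (\<phi> \<circ> inv_into U \<phi>)"
    using W by (intro smooth_on_affine[of "\<lambda>v. v" _ _ 0]) (auto simp: f_inv_into_f)
  then have "smooth_map {(U, \<phi>)} banach_space_atlas \<phi>"
    by (simp add: smooth_map_def banach_space_atlas_def mcarrier_def)
  then show ?thesis
    by (simp add: fredholm_map_def banach_space_atlas_def chart_differential_chart fredholm_operator_identity)
qed

lemma transverse_chart:
  assumes "closed C" "direct_sum S C UNIV"
  shows "transverse_to_subspace {(U, \<phi>)} \<phi> S"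
proof -
  have "0 \<in> S"
    using assms(2) subspace_0 by (auto simp: direct_sum_def)
  then have "\<exists>v s. x = v + s \<and> s \<in> S" for x
    by (intro exI[of _ x] exI[of _ 0]) simp
  then have "{v + s |v s. s \<in> S} = UNIV"
    by blast
  then show ?thesis
    using assms by (auto simp: transverse_to_subspace_def chart_differential_chart)
qed

text \<open>The chart is already a slice chart, so the straightening diffeomorphism is the identity.\<close>

lemma submanifold_dim_linear_slice:
  assumes "N \<subseteq> U" "\<phi> ` N = \<phi> ` U \<inter> F" "has_dim F k"
  shows "submanifold_dim {(U, \<phi>)} k N"
proof -
  have "\<exists>V W (h :: 'm \<Rightarrow> 'm) F. \<phi> x \<in> V \<and> V \<subseteq> \<phi> ` U \<and> diffeo h V W \<and> has_dim F k \<and>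
      h ` (V \<inter> \<phi> ` (N \<inter> U)) = W \<inter> F" if "x \<in> N \<inter> U" for x
    using assms that W
    by (intro exI[of _ "\<phi> ` U"] exI[of _ id] exI[of _ F]) (auto simp: Int_absorb2 diffeo_id)
  then show ?thesis
    using assms(1) by (simp add: submanifold_dim_def mcarrier_def)
qed

text \<open>All tangent spaces of \<open>N\<close> and \<open>P\<close> are the fixed spaces of \<open>p\<close> and \<open>q\<close>, so the normal bundle is a
  product with fibre the kernel of \<open>p\<close> on the fixed space of \<open>q\<close>, trivialised by \<open>v \<mapsto> v - p v\<close>.
  The case \<open>q = id\<close> is the normal bundle in the whole manifold.\<close>

lemma trivial_normal_bundle_linear_slices:
  assumes p: "bounded_linear p" and q: "bounded_linear q"
    and pp: "\<And>v. p (p v) = p v" and qp: "\<And>v. q (p v) = p v"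
    and N: "N = {x \<in> U. p (\<phi> x) = \<phi> x}" and P: "P = {x \<in> U. q (\<phi> x) = \<phi> x}"
  shows "trivial_normal_bundle {(U, \<phi>)} N P"
proof -
  interpret p: bounded_linear p by (rule p)
  interpret q: bounded_linear q by (rule q)
  have "\<phi> ` (N \<inter> U) = \<phi> ` U \<inter> {v. p v = v}" "\<phi> ` (P \<inter> U) = \<phi> ` U \<inter> {v. q v = v}"
    by (auto simp: N P)
  note slices = tangent_space_linear_slice[OF W p this(1)] tangent_space_linear_slice[OF W q this(2)]
  have "p v = v \<Longrightarrow> q v = v" for v
    using qp[of v] by simp
  then have "N \<subseteq> P"
    by (auto simp: N P)
  then have tangent: "tangent_space (U, \<phi>) N x = {v. p v = v}" "tangent_space (U, \<phi>) P x = {v. q v = v}"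
    if "x \<in> N \<inter> U" for x
    using slices that by auto
  define Q where "Q = {v. q v = v} \<inter> {v. p v = 0}"
  define \<tau> where "\<tau> = (\<lambda>(c :: 'a set \<times> ('a \<Rightarrow> 'm)) (x :: 'a) v. v - p v)"
  have "subspace Q"
    by (auto simp: Q_def subspace_def p.add q.add p.scaleR q.scaleR)
  moreover have "closed Q"
    unfolding Q_def by (intro closed_Int closed_Collect_eq continuous_intros p.continuous_on q.continuous_on)
  moreover have "\<tau> c x ` {v. q v = v} = Q" for c x
  proof (intro subset_antisym subsetI)
    fix v assume "v \<in> Q"
    then show "v \<in> \<tau> c x ` {v. q v = v}"
      by (intro image_eqI[of _ _ v]) (auto simp: Q_def \<tau>_def)
  qed (auto simp: Q_def \<tau>_def p.diff q.diff pp qp)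
  moreover have "{v \<in> {v. q v = v}. \<tau> c x v = 0} = {v. p v = v}" for c x
    using \<open>\<And>v. p v = v \<Longrightarrow> q v = v\<close> by (auto simp: \<tau>_def)
  moreover have "\<tau> c x (a *\<^sub>R v + b *\<^sub>R w) = a *\<^sub>R \<tau> c x v + b *\<^sub>R \<tau> c x w" for c x v w a b
    by (simp add: \<tau>_def p.add p.scaleR algebra_simps)
  moreover have "locally_smooth_on S (\<lambda>(y, v). \<tau> c (h y) v)" for S :: "('m \<times> 'm) set" and c h
  proof -
    have "bounded_linear (\<lambda>z :: 'm \<times> 'm. snd z - p (snd z))"
      by (intro bounded_linear_sub bounded_linear_snd bounded_linear_compose[OF p bounded_linear_snd])
    then have "smooth_on UNIV (\<lambda>z :: 'm \<times> 'm. snd z - p (snd z))"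
      by (rule smooth_on_affine[of _ _ _ 0]) auto
    then show ?thesis
      unfolding locally_smooth_on_def by (intro ballI exI[of _ UNIV] exI conjI) (auto simp: \<tau>_def case_prod_unfold)
  qed
  moreover have "\<tau> c x v = \<tau> d x v" for c d x v
    by (simp add: \<tau>_def)
  ultimately show ?thesis
    unfolding trivial_normal_bundle_def
    by (intro exI[of _ Q] exI[of _ \<tau>]) (simp add: tangent chart_differential_chart)
qed

end

text \<open>A commuting family of projections \<open>p n\<close> with increasing ranges that converges pointwise to the
  identity cuts a manifold with a global chart into a Fredholm filtration, with the chart as the
  Fredholm map; only the homotopy equivalence has to be supplied separately.\<close>

lemma global_chart_fredholm_filtration:
  fixes \<phi> :: "'a \<Rightarrow> 'm::banach" and p :: "nat \<Rightarrow> 'm \<Rightarrow> 'm"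
  assumes inj: "inj_on \<phi> U" and W: "open (\<phi> ` U)"
    and haus: "Hausdorff_space (mtopology {(U, \<phi>)})"
    and \<delta>: "strict_mono_on {1..} \<delta>"
    and p: "\<And>n. bounded_linear (p n)"
    and absorb: "\<And>m n v. m \<le> n \<Longrightarrow> p n (p m v) = p m v \<and> p m (p n v) = p m v"
    and lim: "\<And>v. (\<lambda>n. p n v) \<longlonglongrightarrow> v"
    and dim: "\<And>n. n \<ge> 1 \<Longrightarrow> has_dim {v. p n v = v} (\<delta> n)"
    and N: "\<And>n. n \<ge> 1 \<Longrightarrow> N n = {x \<in> U. p n (\<phi> x) = \<phi> x}"
    and equiv: "homotopy_equivalence_map
      (inductive_limit_topology (mtopology {(U, \<phi>)}) N) (mtopology {(U, \<phi>)}) id"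
  shows "fredholm_filtration {(U, \<phi>)} \<delta> N"
proof -
  have lin: "linear (p n)" for n
    using p by (rule bounded_linear.linear)
  have inc: "{v. p n v = v} \<subseteq> {v. p (Suc n) v = v}" for n
  proof (intro subsetI CollectI)
    fix v assume "v \<in> {v. p n v = v}"
    then show "p (Suc n) v = v"
      using absorb[of n "Suc n" v] by simp
  qed
  have compl: "closed {v. p n v = 0} \<and> direct_sum {v. p n v = v} {v. p n v = 0} UNIV" for n
  proof
    show "closed {v. p n v = 0}"
      by (intro closed_Collect_eq continuous_on_const linear_continuous_on p)
    have "v = p n v + (v - p n v) \<and> p n (p n v) = p n v \<and> p n (v - p n v) = 0" for v
      using absorb[of n n] by (simp add: linear_diff[OF lin])
    then have "\<exists>u w. v = u + w \<and> u \<in> {v. p n v = v} \<and> w \<in> {v. p n v = 0}" for v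
      by (intro exI[of _ "p n v"] exI[of _ "v - p n v"]) simp
    then have "{v + w |v w. v \<in> {v. p n v = v} \<and> w \<in> {v. p n v = 0}} = UNIV"
      by blast
    then show "direct_sum {v. p n v = v} {v. p n v = 0} UNIV"
      by (auto simp: direct_sum_def subspace_def linear_add[OF lin] linear_scale[OF lin] linear_0[OF lin])
  qed
  have C_dec: "{v. p (Suc n) v = 0} \<subseteq> {v. p n v = 0}" for n
  proof (intro subsetI CollectI)
    fix v assume "v \<in> {v. p (Suc n) v = 0}"
    then show "p n v = 0"
      using absorb[of n "Suc n" v] linear_0[OF lin, of n] by simp
  qed
  have "v \<in> closure (\<Union>n\<in>{1..}. {v. p n v = v})" for v
    unfolding closure_sequential
    using LIMSEQ_Suc[OF lim[of v]] absorb by (intro exI[of _ "\<lambda>n. p (Suc n) v"]) auto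
  then have flag: "delta_flag \<delta> (\<lambda>n. {v. p n v = v})"
    unfolding delta_flag_def using dim inc compl C_dec
    by (intro conjI exI[of _ "\<lambda>n. {v. p n v = 0}"]) auto
  have manifold: "banach_manifold {(U, \<phi>)}"
    by (rule banach_manifold_global_chart[OF inj W haus])
  have topspace: "topspace (mtopology {(U, \<phi>)}) = U"
  proof
    show "topspace (mtopology {(U, \<phi>)}) \<subseteq> U"
      using openin_topspace[of "mtopology {(U, \<phi>)}"]
      unfolding openin_mtopology[OF manifold] by (simp add: mcarrier_def)
    have "openin (mtopology {(U, \<phi>)}) U"
      unfolding openin_mtopology[OF manifold] using W by (simp add: mcarrier_def)
    then show "U \<subseteq> topspace (mtopology {(U, \<phi>)})"
      by (rule openin_subset)
  qed
  have dense: "mtopology {(U, \<phi>)} closure_of (\<Union>n\<in>{1..}. N n) = U"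
  proof (rule subset_antisym)
    show "mtopology {(U, \<phi>)} closure_of (\<Union>n\<in>{1..}. N n) \<subseteq> U"
      using closure_of_subset_topspace[of "mtopology {(U, \<phi>)}"] topspace by simp
    show "U \<subseteq> mtopology {(U, \<phi>)} closure_of (\<Union>n\<in>{1..}. N n)"
    proof
      fix x assume x: "x \<in> U"
      have "\<exists>y\<in>\<Union>n\<in>{1..}. N n. y \<in> V" if V: "openin (mtopology {(U, \<phi>)}) V" "x \<in> V" for V
      proof -
        have "V \<subseteq> U" "open (\<phi> ` (V \<inter> U))"
          using V(1) unfolding openin_mtopology[OF manifold] by (simp_all add: mcarrier_def)
        then have "open (\<phi> ` V)"
          by (simp add: Int_absorb2)
        then have "\<forall>\<^sub>F n in sequentially. p n (\<phi> x) \<in> \<phi> ` V"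
          using V(2) by (intro topological_tendstoD[OF lim] imageI)
        then have "\<forall>\<^sub>F n in sequentially. p n (\<phi> x) \<in> \<phi> ` V \<and> n \<ge> 1"
          using eventually_ge_at_top[of 1] by (rule eventually_conj)
        from eventually_happens'[OF sequentially_bot this]
        obtain n where n: "p n (\<phi> x) \<in> \<phi> ` V" "n \<ge> 1" by blast
        then obtain y where y: "y \<in> V" "p n (\<phi> x) = \<phi> y" by auto
        then have "p n (\<phi> y) = \<phi> y"
          using absorb[of n n "\<phi> x"] by simp
        then have "y \<in> N n"
          using N[OF n(2)] y \<open>V \<subseteq> U\<close> by auto
        then show ?thesis
          using y n by auto
      qed
      then show "x \<in> mtopology {(U, \<phi>)} closure_of (\<Union>n\<in>{1..}. N n)"
        unfolding in_closure_of using x topspace by blast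
    qed
  qed
  have "\<phi> ` N n = \<phi> ` U \<inter> {v. p n v = v}" if "n \<ge> 1" for n
    using N[OF that] by auto
  then have sub: "submanifold_dim {(U, \<phi>)} (\<delta> n) (N n)" if "n \<ge> 1" for n
    using submanifold_dim_linear_slice[OF inj W _ _ dim[OF that], of "N n"] N[OF that] that by auto
  have "N n \<subseteq> N (Suc n)" if "n \<ge> 1" for n
    using N[OF that] N[of "Suc n"] inc[of n] by auto
  moreover have "trivial_normal_bundle {(U, \<phi>)} (N n) (N (Suc n))" if "n \<ge> 1" for n
    by (rule trivial_normal_bundle_linear_slices[OF inj W p p, of n "Suc n"]) (use that N absorb in auto)
  moreover have "trivial_normal_bundle {(U, \<phi>)} (N n) U" if "n \<ge> 1" for n
    by (rule trivial_normal_bundle_linear_slices[OF inj W p bounded_linear_ident, of n]) (use that N absorb in auto)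
  moreover have "\<exists>(f :: 'a \<Rightarrow> 'm) B. fredholm_map {(U, \<phi>)} banach_space_atlas f 0 \<and> delta_flag \<delta> B \<and>
      (\<forall>n\<ge>1. transverse_to_subspace {(U, \<phi>)} f (B n) \<and> N n = {x \<in> U. f x \<in> B n})"
    using fredholm_map_chart[OF inj W] flag transverse_chart[OF inj W] compl N
    by (intro exI[of _ \<phi>] exI[of _ "\<lambda>n. {v. p n v = v}"]) auto
  ultimately show ?thesis
    unfolding fredholm_filtration_def using manifold \<delta> sub dense equiv
    by (simp add: mcarrier_def)
qed

section \<open>Compression to finite matrices\<close>

definition compression :: "(nat \<Rightarrow> 'e::banach) \<Rightarrow> nat \<Rightarrow> 'e compact_op \<Rightarrow> 'e compact_op" where
  "compression e n K = Compact_op (basis_proj e n o\<^sub>L op_of K o\<^sub>L basis_proj e n)"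

text \<open>The operator \<open>x \<mapsto> e\<^sub>j\<^sup>*(x) e\<^sub>i\<close>, whose matrix in the basis has a single entry 1, in row \<open>i\<close> and
  column \<open>j\<close>.\<close>

definition matrix_unit :: "(nat \<Rightarrow> 'e::banach) \<Rightarrow> nat \<times> nat \<Rightarrow> 'e compact_op" where
  "matrix_unit e = (\<lambda>(i, j). Compact_op (blinfun_scaleR_left (e i) o\<^sub>L basis_coord e j))"

lemma op_of_matrix_unit: "op_of (matrix_unit e (i, j)) x = basis_coord e j x *\<^sub>R e i"
  by (simp add: matrix_unit_def op_of_Compact_op compact_operator_rank_one)

context
  fixes e :: "nat \<Rightarrow> 'e::banach"
  assumes basis: "schauder_basis e"
begin

text \<open>This finite-rank formula holds for every bounded \<open>T\<close>.  It makes the compression compact, and for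
  compact \<open>T\<close> it is the expansion in matrix units.\<close>

lemma two_sided_compression_eq_sum:
  "basis_proj e n o\<^sub>L T o\<^sub>L basis_proj e n =
    (\<Sum>(i, j)\<in>{..<n} \<times> {..<n}. basis_coord e i (T (e j)) *\<^sub>R (blinfun_scaleR_left (e i) o\<^sub>L basis_coord e j))"
  (is "?L = ?R")
proof (rule blinfun_eqI)
  fix x
  have entry: "basis_coord e i (T (basis_proj e n x)) = (\<Sum>j<n. basis_coord e j x * basis_coord e i (T (e j)))" for i
    by (simp add: basis_proj_apply[OF basis] blinfun.sum_right blinfun.scaleR_right)
  have "?L x = (\<Sum>i<n. (\<Sum>j<n. basis_coord e j x * basis_coord e i (T (e j))) *\<^sub>R e i)"
    by (simp only: blinfun_apply_blinfun_compose basis_proj_apply[OF basis, of n "T (basis_proj e n x)"] entry)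
  also have "\<dots> = ?R x"
    by (simp add: blinfun.sum_left blinfun.scaleR_left scaleR_sum_left mult.commute
        sum.cartesian_product case_prod_unfold)
  finally show "?L x = ?R x" .
qed

lemma compact_two_sided_compression: "compact_operator (basis_proj e n o\<^sub>L T o\<^sub>L basis_proj e n)"
  unfolding two_sided_compression_eq_sum
  by (intro compact_operator_sum) (auto intro!: compact_operator_scaleR compact_operator_rank_one)

lemma op_of_compression: "op_of (compression e n K) = basis_proj e n o\<^sub>L op_of K o\<^sub>L basis_proj e n"
  by (simp add: compression_def op_of_Compact_op compact_two_sided_compression)

lemma compression_fixed_iff:
  "compression e n K = K \<longleftrightarrow> basis_proj e n o\<^sub>L op_of K o\<^sub>L basis_proj e n = op_of K"
  by (metis op_of_compression op_of_inject)

lemma bounded_linear_compression: "bounded_linear (compression e n)"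
proof (rule bounded_linear_intro[where K = "norm (basis_proj e n) * norm (basis_proj e n)"])
  fix K L :: "'e compact_op" and r :: real
  show "compression e n (K + L) = compression e n K + compression e n L"
    "compression e n (r *\<^sub>R K) = r *\<^sub>R compression e n K"
    unfolding op_of_inject[symmetric] op_of_simps op_of_compression
    by (intro blinfun_eqI; simp add: blinfun.bilinear_simps)+
  have "norm (basis_proj e n o\<^sub>L op_of K o\<^sub>L basis_proj e n)
      \<le> norm (basis_proj e n) * norm (op_of K) * norm (basis_proj e n)"
    by (meson norm_blinfun_compose mult_right_mono norm_ge_zero order_trans)
  then show "norm (compression e n K) \<le> norm K * (norm (basis_proj e n) * norm (basis_proj e n))"
    by (simp add: norm_compact_op_def op_of_compression mult_ac)
qed

lemma compression_absorb:
  assumes "m \<le> n"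
  shows "compression e n (compression e m K) = compression e m K"
    and "compression e m (compression e n K) = compression e m K"
proof -
  note absorb = basis_proj_absorb[OF basis assms, THEN arg_cong[where f = blinfun_apply], THEN fun_cong]
  show "compression e n (compression e m K) = compression e m K"
    "compression e m (compression e n K) = compression e m K"
    unfolding op_of_inject[symmetric] op_of_compression
    by (intro blinfun_eqI; use absorb in simp)+
qed

lemma entry_matrix_unit:
  "basis_coord e i (op_of (matrix_unit e (k, l)) (e j)) = (if i = k \<and> j = l then 1 else 0)"
  by (auto simp: op_of_matrix_unit blinfun.scaleR_right basis_coord_basis_vector[OF basis])

lemma inj_matrix_unit: "inj (matrix_unit e)"
proof (rule injI)
  fix p q assume eq: "matrix_unit e p = matrix_unit e q"
  obtain i j where p: "p = (i, j)" by force
  obtain k l where q: "q = (k, l)" by force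
  show "p = q"
    using entry_matrix_unit[of i i j j] entry_matrix_unit[of i k l j] eq
    unfolding p q by (auto split: if_splits)
qed

lemma compression_eq_sum:
  "compression e n K =
    (\<Sum>p\<in>{..<n} \<times> {..<n}. basis_coord e (fst p) (op_of K (e (snd p))) *\<^sub>R matrix_unit e p)"
proof -
  have "op_of (matrix_unit e p) = blinfun_scaleR_left (e (fst p)) o\<^sub>L basis_coord e (snd p)" for p
    by (simp add: matrix_unit_def case_prod_unfold op_of_Compact_op compact_operator_rank_one)
  then show ?thesis
    unfolding op_of_inject[symmetric] op_of_compression two_sided_compression_eq_sum
    by (simp add: op_of_sum case_prod_unfold)
qed

lemma compression_matrix_unit:
  assumes "p \<in> {..<n} \<times> {..<n}"
  shows "compression e n (matrix_unit e p) = matrix_unit e p"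
proof -
  obtain k l where p: "p = (k, l)" by force
  have "compression e n (matrix_unit e p) = (\<Sum>q\<in>{..<n} \<times> {..<n}. if q = p then matrix_unit e q else 0)"
    unfolding compression_eq_sum
    by (rule sum.cong) (auto simp: p entry_matrix_unit)
  then show ?thesis
    using assms by simp
qed

lemma has_dim_compression_range: "has_dim {K. compression e n K = K} (n\<^sup>2)"
  unfolding has_dim_def
proof (intro exI conjI)
  let ?I = "{..<n} \<times> {..<n}"
  let ?B = "matrix_unit e ` ?I"
  have inj: "inj_on (matrix_unit e) ?I"
    using inj_matrix_unit by (rule inj_on_subset) simp
  show "finite ?B" by simp
  show "card ?B = n\<^sup>2"
    by (simp add: card_image[OF inj] card_cartesian_product power2_eq_square)
  show "independent ?B"
  proof (rule independent_if_scalars_zero)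
    fix c K assume zero: "(\<Sum>K\<in>?B. c K *\<^sub>R K) = 0" and K: "K \<in> ?B"
    obtain i j where ij: "K = matrix_unit e (i, j)" "(i, j) \<in> ?I"
      using K by auto
    have "0 = basis_coord e i (op_of (\<Sum>p\<in>?I. c (matrix_unit e p) *\<^sub>R matrix_unit e p) (e j))"
      using zero by (simp add: sum.reindex[OF inj] blinfun.zero_right)
    also have "\<dots> = (\<Sum>p\<in>?I. c (matrix_unit e p) * basis_coord e i (op_of (matrix_unit e p) (e j)))"
      by (simp add: op_of_sum blinfun.sum_left blinfun.sum_right blinfun.scaleR_left blinfun.scaleR_right)
    also have "\<dots> = (\<Sum>p\<in>?I. if p = (i, j) then c (matrix_unit e p) else 0)"
      by (rule sum.cong) (auto simp: entry_matrix_unit split: if_splits)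
    also have "\<dots> = c K"
      using ij by simp
    finally show "c K = 0" by simp
  qed simp
  show "span ?B = {K. compression e n K = K}"
  proof (rule subset_antisym)
    have "subspace {K. compression e n K = K}"
      using bounded_linear.linear[OF bounded_linear_compression, of n]
      by (auto simp: subspace_def linear_0 linear_add linear_scale)
    then show "span ?B \<subseteq> {K. compression e n K = K}"
      by (intro span_minimal) (auto simp: compression_matrix_unit)
    show "{K. compression e n K = K} \<subseteq> span ?B"
    proof clarify
      fix K assume "compression e n K = K"
      moreover have "compression e n K \<in> span ?B"
        unfolding compression_eq_sum by (intro span_sum span_scale span_base) auto
      ultimately show "K \<in> span ?B" by simp
    qed
  qed
qed

text \<open>\<open>T\<close> is the identity on the tail iff \<open>T - I\<close> vanishes there, that is \<open>(T - I) P\<^sub>n = T - I\<close>; and then \<open>T\<close>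
  preserves the head iff \<open>T - I\<close> takes values in the head, that is \<open>P\<^sub>n (T - I) = T - I\<close>.\<close>

lemma GL_fin_eq:
  "GL_fin e n = {T \<in> GL. basis_proj e n o\<^sub>L (T - id_blinfun) o\<^sub>L basis_proj e n = T - id_blinfun}"
proof (intro subset_antisym subsetI)
  fix T assume T: "T \<in> GL_fin e n"
  have "(basis_proj e n o\<^sub>L (T - id_blinfun) o\<^sub>L basis_proj e n) x = (T - id_blinfun) x" for x
  proof -
    have "T (x - basis_proj e n x) = x - basis_proj e n x"
      using T diff_basis_proj_in_tail[OF basis] by (auto simp: GL_fin_def)
    then have "(T - id_blinfun) x = T (basis_proj e n x) - basis_proj e n x"
      by (simp add: blinfun.bilinear_simps algebra_simps)
    moreover have "T (basis_proj e n x) - basis_proj e n x \<in> head_space e n"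
      using T basis_proj_in_head[OF basis] unfolding GL_fin_def head_space_def
      by (intro span_diff) auto
    ultimately show ?thesis
      using basis_proj_head[OF basis] by (simp add: blinfun.diff_left)
  qed
  then have "basis_proj e n o\<^sub>L (T - id_blinfun) o\<^sub>L basis_proj e n = T - id_blinfun"
    by (rule blinfun_eqI)
  then show "T \<in> {T \<in> GL. basis_proj e n o\<^sub>L (T - id_blinfun) o\<^sub>L basis_proj e n = T - id_blinfun}"
    using T by (simp add: GL_fin_def)
next
  fix T assume "T \<in> {T \<in> GL. basis_proj e n o\<^sub>L (T - id_blinfun) o\<^sub>L basis_proj e n = T - id_blinfun}"
  then have T: "T \<in> GL" and eq: "T - id_blinfun = basis_proj e n o\<^sub>L (T - id_blinfun) o\<^sub>L basis_proj e n"
    by auto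
  have T_apply: "T x = x + basis_proj e n ((T - id_blinfun) (basis_proj e n x))" for x
  proof -
    have "T x - x = (T - id_blinfun) x"
      by (simp add: blinfun.diff_left)
    also have "\<dots> = basis_proj e n ((T - id_blinfun) (basis_proj e n x))"
      by (subst eq) simp
    finally show ?thesis by (simp add: algebra_simps)
  qed
  have "T x \<in> head_space e n" if "x \<in> head_space e n" for x
    using that basis_proj_in_head[OF basis] unfolding T_apply[of x] head_space_def by (intro span_add)
  moreover have "T x = x" if "x \<in> tail_space e n" for x
    unfolding T_apply[of x] basis_proj_tail[OF basis that] by (simp add: blinfun.zero_right)
  ultimately show "T \<in> GL_fin e n"
    using T by (auto simp: GL_fin_def)
qed

lemma GL_fin_subset_GL_K: "GL_fin e n \<subseteq> GL_K"
proof
  fix T assume "T \<in> GL_fin e n"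
  then have "T \<in> GL" and eq: "basis_proj e n o\<^sub>L (T - id_blinfun) o\<^sub>L basis_proj e n = T - id_blinfun"
    by (simp_all add: GL_fin_eq)
  then show "T \<in> GL_K"
    using compact_two_sided_compression[of n "T - id_blinfun"] unfolding eq by (simp add: GL_K_def)
qed

end

lemma compression_tendsto:
  assumes "shrinking_basis e"
  shows "(\<lambda>n. compression e n K) \<longlonglongrightarrow> K"
proof -
  have basis: "schauder_basis e"
    using assms by (simp add: shrinking_basis_def)
  have "(\<lambda>n. op_of (compression e n K)) \<longlonglongrightarrow> op_of K"
    unfolding op_of_compression[OF basis] using assms by (rule compact_compose_basis_proj_tendsto) simp
  then show ?thesis
    by (simp add: LIMSEQ_iff norm_compact_op_def)
qed

section \<open>The Fredholm group and its finite-dimensional subgroups\<close>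

abbreviation GL_K_chart :: "('e::banach \<Rightarrow>\<^sub>L 'e) \<Rightarrow> 'e compact_op" where
  "GL_K_chart T \<equiv> Compact_op (T - id_blinfun)"

lemma op_of_GL_K_chart: "T \<in> GL_K \<Longrightarrow> op_of (GL_K_chart T) = T - id_blinfun"
  by (simp add: GL_K_def op_of_Compact_op)

lemma GL_K_chart_image: "GL_K_chart ` GL_K = {K. id_blinfun + op_of K \<in> GL}"
proof (intro subset_antisym subsetI)
  fix K :: "'a compact_op" assume "K \<in> {K. id_blinfun + op_of K \<in> GL}"
  then have "id_blinfun + op_of K \<in> GL_K" "K = GL_K_chart (id_blinfun + op_of K)"
    by (simp_all add: GL_K_def op_of_inverse)
  then show "K \<in> GL_K_chart ` GL_K"
    by (rule rev_image_eqI)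
next
  fix K :: "'a compact_op" assume "K \<in> GL_K_chart ` GL_K"
  then obtain T where "T \<in> GL_K" "K = GL_K_chart T" by blast
  then show "K \<in> {K. id_blinfun + op_of K \<in> GL}"
    using op_of_GL_K_chart[of T] by (simp add: GL_K_def)
qed

text \<open>The chart is an isometry for the operator norm, so the manifold topology of \<open>GL_K\<close> is the norm
  topology.\<close>

lemma homeomorphic_map_GL_K_chart:
  "homeomorphic_map (top_of_set GL_K) (top_of_set (GL_K_chart ` GL_K)) (GL_K_chart :: ('e::banach \<Rightarrow>\<^sub>L 'e) \<Rightarrow> _)"
proof -
  let ?\<phi> = "GL_K_chart :: ('e \<Rightarrow>\<^sub>L 'e) \<Rightarrow> _" and ?\<psi> = "\<lambda>K. id_blinfun + op_of K"
  have "dist (?\<phi> S) (?\<phi> T) = dist S T" if "S \<in> GL_K" "T \<in> GL_K" for S T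
    using that by (simp add: dist_norm norm_compact_op_def op_of_GL_K_chart)
  then have "continuous_on GL_K ?\<phi>"
    unfolding continuous_on_iff by metis
  moreover have "continuous_on (?\<phi> ` GL_K) ?\<psi>"
    by (intro continuous_intros linear_continuous_on bounded_linear_op_of)
  moreover have "?\<psi> (?\<phi> T) = T" if "T \<in> GL_K" for T
    using op_of_GL_K_chart[OF that] by simp
  ultimately have "homeomorphic_maps (top_of_set GL_K) (top_of_set (?\<phi> ` GL_K)) ?\<phi> ?\<psi>"
    by (auto simp: homeomorphic_maps_def op_of_inverse)
  then show ?thesis
    by (auto simp: homeomorphic_map_maps)
qed

text \<open>The approximations are \<open>R\<^sub>n T = I + c\<^sub>n (T - I)\<close>, whose common Lipschitz constant is the square of a
  uniform bound \<open>C\<close> for the norms of the basis projections.\<close>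

lemma GL_fin_homotopy_equivalence:
  fixes e :: "nat \<Rightarrow> 'e::banach"
  assumes shr: "shrinking_basis e"
  shows "homotopy_equivalence_map (inductive_limit_topology (top_of_set GL_K) (GL_fin e)) (top_of_set GL_K) id"
proof -
  have basis: "schauder_basis e"
    using shr by (simp add: shrinking_basis_def)
  obtain C where C: "\<And>n. norm (basis_proj e n) \<le> C"
    using basis_proj_bounded[OF basis] by blast
  have C0: "C \<ge> 0"
    using C[of 0] norm_ge_zero order_trans by blast
  define A where "A = {T :: 'e \<Rightarrow>\<^sub>L 'e. compact_operator (T - id_blinfun)}"
  define c where "c n T = basis_proj e n o\<^sub>L T o\<^sub>L basis_proj e n" for n and T :: "'e \<Rightarrow>\<^sub>L 'e"
  define B where "B n = {T \<in> A. c n (T - id_blinfun) = T - id_blinfun}" for n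
  have c_lin: "c n (u *\<^sub>R S + v *\<^sub>R T) = u *\<^sub>R c n S + v *\<^sub>R c n T" for n u v S T
    unfolding c_def by (rule blinfun_eqI) (simp add: blinfun.bilinear_simps)
  have c_absorb: "c n (c m T) = c m T" if "m \<le> n" for m n T
    using basis_proj_absorb[OF basis that, THEN arg_cong[where f = blinfun_apply], THEN fun_cong]
    unfolding c_def by (intro blinfun_eqI) simp
  have affine: "u *\<^sub>R S + v *\<^sub>R T - id_blinfun = u *\<^sub>R (S - id_blinfun) + v *\<^sub>R (T - id_blinfun)"
    if "u + v = 1" for u v :: real and S T :: "'e \<Rightarrow>\<^sub>L 'e"
  proof -
    have "id_blinfun = (u + v) *\<^sub>R (id_blinfun :: 'e \<Rightarrow>\<^sub>L 'e)"
      using that by simp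
    then show ?thesis
      by (simp add: algebra_simps)
  qed
  show ?thesis
  proof (rule inductive_limit_inclusion_homotopy_equivalence
      [where A = A and U = GL and B = B and R = "\<lambda>n T. id_blinfun + c n (T - id_blinfun)" and C = "C * C"])
    show "GL_K = A \<inter> GL"
      by (auto simp: GL_K_def A_def)
    show "open (GL :: ('e \<Rightarrow>\<^sub>L 'e) set)"
      by (rule open_GL)
    show convA: "convex A"
      by (rule convexI) (simp add: A_def affine compact_operator_add compact_operator_scaleR)
    show "convex (B n) \<and> B n \<subseteq> A \<and> B n \<subseteq> B (Suc n)" if "n \<ge> 1" for n
    proof (intro conjI)
      show "convex (B n)"
        using convA by (auto simp: convex_def B_def affine c_lin)
      show "B n \<subseteq> B (Suc n)"
      proof
        fix T assume T: "T \<in> B n"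
        then have "c (Suc n) (c n (T - id_blinfun)) = c n (T - id_blinfun)"
          by (intro c_absorb) simp
        then show "T \<in> B (Suc n)"
          using T by (simp add: B_def)
      qed
    qed (auto simp: B_def)
    show "GL_fin e n = GL_K \<inter> B n" if "n \<ge> 1" for n
      using GL_fin_subset_GL_K[OF basis, of n]
      unfolding GL_fin_eq[OF basis] by (auto simp: GL_K_def B_def A_def c_def)
    show "norm (id_blinfun + c n (S - id_blinfun) - (id_blinfun + c n (T - id_blinfun))) \<le> C * C * norm (S - T)" for n S T
    proof -
      have "id_blinfun + c n (S - id_blinfun) - (id_blinfun + c n (T - id_blinfun)) = c n (S - T)"
        unfolding c_def by (rule blinfun_eqI) (simp add: blinfun.bilinear_simps)
      moreover have "norm (c n (S - T)) \<le> (norm (basis_proj e n) * norm (S - T)) * norm (basis_proj e n)"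
        unfolding c_def by (meson norm_blinfun_compose mult_right_mono norm_ge_zero order_trans)
      moreover have "\<dots> \<le> (C * norm (S - T)) * C"
        using C C0 by (intro mult_mono) auto
      ultimately show ?thesis
        by (simp add: mult_ac)
    qed
    show "(\<lambda>n. id_blinfun + c n (T - id_blinfun)) \<longlonglongrightarrow> T" if "T \<in> A" for T
      using tendsto_add[OF tendsto_const[of id_blinfun] compact_compose_basis_proj_tendsto[OF shr, of "T - id_blinfun"]] that
      by (simp add: A_def c_def)
    show "id_blinfun + c n (T - id_blinfun) \<in> B n" for n T
      using c_absorb[of n n] compact_two_sided_compression[OF basis] by (simp add: B_def A_def c_def)
  qed
qed

theorem corollary8:
  fixes e :: "nat \<Rightarrow> 'e::banach"
  assumes "separable_space (euclidean :: 'e topology)"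
    and "\<not> (\<exists>n. has_dim (UNIV :: 'e set) n)"
    and "shrinking_basis e"
  shows "fredholm_filtration (GL_K_atlas :: ('e \<Rightarrow>\<^sub>L 'e, 'e compact_op) atlas)
           (\<lambda>n. n\<^sup>2) (GL_fin e)"
proof -
  have basis: "schauder_basis e"
    using assms(3) by (simp add: shrinking_basis_def)
  let ?\<phi> = "GL_K_chart :: ('e \<Rightarrow>\<^sub>L 'e) \<Rightarrow> _"
  have W: "open (?\<phi> ` GL_K)"
  proof -
    have eq: "?\<phi> ` GL_K = (\<lambda>K. id_blinfun + op_of K) -` GL"
      by (simp add: GL_K_chart_image vimage_def)
    have cont: "continuous_on UNIV (\<lambda>K :: 'e compact_op. id_blinfun + op_of K)"
      by (intro continuous_intros linear_continuous_on bounded_linear_op_of)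
    show ?thesis
      unfolding eq by (rule open_vimage[OF open_GL cont])
  qed
  have top: "mtopology {(GL_K, ?\<phi>)} = top_of_set GL_K"
    using mtopology_global_chart[of "top_of_set GL_K" ?\<phi>] homeomorphic_map_GL_K_chart W by simp
  have "fredholm_filtration {(GL_K, ?\<phi>)} (\<lambda>n. n\<^sup>2) (GL_fin e)"
  proof (rule global_chart_fredholm_filtration[where p = "compression e"])
    show "inj_on ?\<phi> GL_K"
      by (rule inj_on_inverseI[where g = "\<lambda>K. id_blinfun + op_of K"]) (simp add: op_of_GL_K_chart)
    show "open (?\<phi> ` GL_K)"
      by (rule W)
    show "Hausdorff_space (mtopology {(GL_K, ?\<phi>)})"
      unfolding top by (intro Hausdorff_space_subtopology Hausdorff_space_euclidean)
    show "strict_mono_on {1..} (\<lambda>n::nat. n\<^sup>2)"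
      by (auto simp: strict_mono_on_def intro: power_strict_mono)
    show "bounded_linear (compression e n)" for n
      by (rule bounded_linear_compression[OF basis])
    show "compression e n (compression e m K) = compression e m K \<and>
        compression e m (compression e n K) = compression e m K" if "m \<le> n" for m n K
      using compression_absorb[OF basis that] by blast
    show "(\<lambda>n. compression e n K) \<longlonglongrightarrow> K" for K
      by (rule compression_tendsto[OF assms(3)])
    show "has_dim {K. compression e n K = K} (n\<^sup>2)" for n
      by (rule has_dim_compression_range[OF basis])
    show "GL_fin e n = {T \<in> GL_K. compression e n (?\<phi> T) = ?\<phi> T}" for n
    proof (intro set_eqI iffI)
      fix T assume T: "T \<in> GL_fin e n"
      then have "T \<in> GL_K"
        using GL_fin_subset_GL_K[OF basis] by blast
      with T show "T \<in> {T \<in> GL_K. compression e n (?\<phi> T) = ?\<phi> T}"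
        by (simp add: GL_fin_eq[OF basis] compression_fixed_iff[OF basis] op_of_GL_K_chart)
    next
      fix T assume "T \<in> {T \<in> GL_K. compression e n (?\<phi> T) = ?\<phi> T}"
      then have T: "T \<in> GL_K" and fixed: "compression e n (?\<phi> T) = ?\<phi> T"
        by simp_all
      show "T \<in> GL_fin e n"
        using T fixed[unfolded compression_fixed_iff[OF basis] op_of_GL_K_chart[OF T]]
        by (simp add: GL_fin_eq[OF basis] GL_K_def)
    qed
    show "homotopy_equivalence_map (inductive_limit_topology (mtopology {(GL_K, ?\<phi>)}) (GL_fin e))
        (mtopology {(GL_K, ?\<phi>)}) id"
      unfolding top by (rule GL_fin_homotopy_equivalence[OF assms(3)])
  qed
  then show ?thesis
    by (simp add: GL_K_atlas_def)
qed

end
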